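(* Let $K$ be a field of positive characteristic, $S=K[x_1,\ldots,x_N]$, and let $I\subseteq S$ be an ideal. Suppose there are prime ideals $\mathfrak{p}_1,\ldots,\mathfrak{p}_k$ of $S$ and a polytope $P\subseteq\mathbb{R}^k$ such that $$\overline{I^s}=\sum_{(a_1,\ldots,a_k)\in P}\left(\bigcap_{i=1}^k\mathfrak{p}_i^{(\lceil sa_i\rceil)}\right)\qquad\text{for all } s\gg0,$$ and suppose there exist a term ordering $\prec$ on $S$ and a polynomial $F\in S$ such that (i) $\operatorname{in}_\prec(F)$ is a square-free monomial, and (ii) $F\in\mathfrak{p}_i^{(\operatorname{ht}(\mathfrak{p}_i))}$ for all $i=1,\ldots,k$. Then $$\tau(\lambda\bullet I)=\sum_{(a_1,\ldots,a_k)\in P}\left(\bigcap_{i=1}^k\mathfrak{p}_i^{(\lfloor\lambda a_i\rfloor+1-\operatorname{ht}(\mathfrak{p}_i))}\right)\qquad\text{for all }\lambda\in\mathbb{R}_{>0}.$$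
   Context: $\overline{I^s}$ is the integral closure of $I^s$. For a prime $\mathfrak{p}$ of $S$, $\mathfrak{p}^{(\ell)}=\mathfrak{p}^\ell S_{\mathfrak{p}}\cap S$ is the $\ell$-th symbolic power for $\ell\ge1$, and $\mathfrak{p}^{(\ell)}=S$ for $\ell\le0$. $\operatorname{in}_\prec(F)$ is the initial (leading) monomial of $F$ with respect to $\prec$; a polytope is the convex hull of a finite set of points. Test ideals: let $p=\operatorname{char}(K)$. For $q=p^e$ and an ideal $J$, $J^{[q]}=(f^q:f\in J)$ is the Frobenius power, and $J^{[1/q]}$ is the smallest ideal $L\subseteq S$ with $J\subseteq L^{[q]}$. For $\lambda\in\mathbb{R}_{>0}$ the test ideal is $\tau(\lambda\bullet I)=\bigcup_{e>0}\big(I^{\lceil\lambda p^e\rceil}\big)^{[1/p^e]}$, an increasing union, equal to $\big(I^{\lceil\lambda p^e\rceil}\big)^{[1/p^e]}$ for $e\gg0$.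
   Formalization: The prime ideals 𝔭_i are additionally assumed nonzero; otherwise the claim fails, e.g. I=S, k=1, 𝔭_1=(0), P={0}, F=x_1, where τ(λ•I)=S but the right-hand side is 𝔭_1^{(1)}=0. *)

theory Defs
  imports
    "HOL-Analysis.Analysis"
    "HOL-Algebra.Algebraic_Closure_Type"
    "HOL-Algebra.Ideal_Product"
    "HOL-Library.Poly_Mapping"
    "HOL-Computational_Algebra.Fraction_Field"
begin

no_notation fps_nth (infixl \<open>$\<close> 75)

text \<open>
  Polynomials over \<open>'a\<close> in variables indexed by \<open>'n\<close>; a monomial is represented by its
  exponent vector.  The index type will be finite and linearly ordered; its order is used only by
  the library instance making the polynomial ring an integral domain (so that it has a fraction
  field), and it has nothing to do with term orderings.

  Ideals of a commutative ring type are ideals, in the sense of \<open>HOL-Algebra\<close>, of the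
  library's structure \<^const>\<open>ring_of_type_algebra\<close> whose carrier is the whole type.
\<close>

type_synonym 'n monom = "'n \<Rightarrow>\<^sub>0 nat"
type_synonym ('n, 'a) mpoly = "'n monom \<Rightarrow>\<^sub>0 'a"

abbreviation is_ideal :: "'r::comm_ring_1 set \<Rightarrow> bool" where
  "is_ideal I \<equiv> ideal I ring_of_type_algebra"

abbreviation is_prime_ideal :: "'r::comm_ring_1 set \<Rightarrow> bool" where
  "is_prime_ideal P \<equiv> primeideal P ring_of_type_algebra"

abbreviation ideal_gen :: "'r::comm_ring_1 set \<Rightarrow> 'r set" where
  "ideal_gen A \<equiv> genideal ring_of_type_algebra A"

abbreviation ideal_pow :: "'r::comm_ring_1 set \<Rightarrow> nat \<Rightarrow> 'r set" where
  "ideal_pow I n \<equiv> I [^]\<^bsub>ideals_set ring_of_type_algebra\<^esub> n"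

definition ideal_family_sum :: "'b set \<Rightarrow> ('b \<Rightarrow> 'r::comm_ring_1 set) \<Rightarrow> 'r set" where
  "ideal_family_sum A J = ideal_gen (\<Union>a\<in>A. J a)"

definition integral_closure :: "'r::comm_ring_1 set \<Rightarrow> 'r set" where
  "integral_closure I =
     {r. \<exists>n>0. \<exists>c. (\<forall>i\<in>{1..n}. c i \<in> ideal_pow I i) \<and>
                    r ^ n + (\<Sum>i=1..n. c i * r ^ (n - i)) = 0}"

definition height :: "'r::comm_ring_1 set \<Rightarrow> enat" where
  "height P = Sup {enat n | n. \<exists>Q. (\<forall>i\<le>n. is_prime_ideal (Q i)) \<and>
                                   (\<forall>i<n. Q i \<subset> Q (Suc i)) \<and> Q n = P}"

text \<open>Heights of primes in polynomial rings over a field are finite, so nothing is lost by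
  reading them as integers.\<close>

abbreviation ht :: "'r::comm_ring_1 set \<Rightarrow> int" where
  "ht P \<equiv> int (the_enat (height P))"

text \<open>The exponents \<open>\<lfloor>t * a\<rfloor> + 1 - ht P\<close> below are appropriate for nonzero primes only:
  for \<open>P = {0}\<close>, \<open>a = 0\<close> the symbolic power with exponent \<open>\<lceil>s * a\<rceil> = 0\<close> is the whole ring, while the one
  with exponent \<open>\<lfloor>t * a\<rfloor> + 1 - 0 = 1\<close> is zero.\<close>

text \<open>The localization of a domain at a prime, as a subring of the fraction field.\<close>

definition localization :: "'r::idom set \<Rightarrow> 'r fract ring" where
  "localization P = ring_of_type_algebra \<lparr>carrier := {Fract a b | a b. b \<notin> P}\<rparr>"

definition symbolic_power :: "'r::idom set \<Rightarrow> int \<Rightarrow> 'r set" where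
  "symbolic_power P l =
     (if l \<le> 0 then UNIV
      else {f. Fract f 1 \<in> genideal (localization P) ((\<lambda>g. Fract g 1) ` ideal_pow P (nat l))})"

definition frobenius_power :: "nat \<Rightarrow> 'r::comm_ring_1 set \<Rightarrow> 'r set" where
  "frobenius_power q J = ideal_gen ((\<lambda>f. f ^ q) ` J)"

definition frobenius_root :: "nat \<Rightarrow> 'r::comm_ring_1 set \<Rightarrow> 'r set" where
  "frobenius_root q J = (LEAST L. is_ideal L \<and> J \<subseteq> frobenius_power q L)"

text \<open>The number \<open>p\<close> is meant to be the (positive) characteristic of the coefficient field.\<close>

definition test_ideal :: "nat \<Rightarrow> real \<Rightarrow> 'r::comm_ring_1 set \<Rightarrow> 'r set" where
  "test_ideal p t I =
     (\<Union>e\<in>{0<..}. frobenius_root (p ^ e) (ideal_pow I (nat \<lceil>t * real (p ^ e)\<rceil>)))"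

definition term_order :: "'n monom rel \<Rightarrow> bool" where
  "term_order ord \<longleftrightarrow> linear_order ord \<and> (\<forall>m. (0, m) \<in> ord) \<and>
     (\<forall>m m' u. (m, m') \<in> ord \<longrightarrow> (m + u, m' + u) \<in> ord)"

definition initial_monom :: "'n monom rel \<Rightarrow> ('n, 'a::zero) mpoly \<Rightarrow> 'n monom" where
  "initial_monom ord F = (THE m. m \<in> Poly_Mapping.keys F \<and> (\<forall>m'\<in>Poly_Mapping.keys F. (m', m) \<in> ord))"

definition squarefree_monom :: "'n monom \<Rightarrow> bool" where
  "squarefree_monom m \<longleftrightarrow> (\<forall>i. Poly_Mapping.lookup m i \<le> 1)"

end

(* For q = p^e the polynomial ring is free over its subring of q-th powers, so membership in a
   Frobenius power L^[q] can be tested by p^(-e)-linear maps ("cartier" below).  Hence roots J^[1/q]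
   exist, L^[q] : g^q = (L : g)^[q], and L^[q] commutes with intersections.

   Inclusion of the test ideal in the sum: at a prime P of height h the ideal P is generated by h
   elements (pseudo-division in one variable at a time, along a chain of primes contracted from
   subsets of the variables), so a pigeonhole argument puts the m-th symbolic power of P into the
   q-th Frobenius power of its k-th one if m >= q(k - 1) + h(q - 1) + 1.

   Converse: if f lies in the symbolic powers for a point a of P, then f^q F^(q-1) lies, for large q,
   in the integral closure of I^(n + l), where n = ceil(t q) and l is the number of generators of I,
   hence in I^n by the theorem of Briancon and Skoda.  As the leading monomial of F is squarefree,
   some p^(-e)-linear map sends F^(q-1) to a nonzero constant, and f lies in (I^n)^[1/q]. *)

theory Submission
  imports Defs
begin

text \<open>The coefficient field need not be perfect, nor even finite over its p-th powers, so the
  basis of the ring over its q-th powers may be infinite. A single polynomial involves only finitely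
  many basis elements, and this is enough for all tests by coordinates.

  The hypothesis describes integral closures, whereas test ideals are built from ordinary powers.
  One inclusion only needs that a power lies in its closure. The other loses l in the exponent, and
  pays for this constant with the strict inequality floor(t a) + 1 > t a, whose gap is multiplied by
  q.

  The pigeonhole bound must involve the height of P and not the number of its global generators,
  which forces the passage to the localization. Its term h(q - 1) is matched by the order of F^(q-1)
  along P, which is at least h(q - 1); therefore both inclusions meet at the exponent floor(t a) + 1
  - h. Heights enter these formulas as integers, so chains of primes have to be bounded beforehand,
  which is done by counting monomials.\<close>

section \<open>Ideals and symbolic powers\<close>

hide_const (open) Divisibility.prime

declare Group.nat_pow_0 [simp del] Group.nat_pow_Suc [simp del] Group.pow_nat [simp del]

lemma ring_of_type_algebra_simps [simp]:
  "carrier ring_of_type_algebra = UNIV" "monoid.mult ring_of_type_algebra = (*)"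
  "one ring_of_type_algebra = 1" "zero ring_of_type_algebra = 0" "add ring_of_type_algebra = (+)"
  by (simp_all add: ring_of_type_algebra_def)

text \<open>Multiplication by -1 supplies additive inverses, so three closure conditions suffice.
  Later arguments about ideals of the whole type use this form.\<close>

lemma is_ideal_iff:
  "is_ideal I \<longleftrightarrow> 0 \<in> I \<and> (\<forall>x\<in>I. \<forall>y\<in>I. x + y \<in> I) \<and> (\<forall>x\<in>I. \<forall>r. r * x \<in> I)"
  for I :: "'r::comm_ring_1 set"
proof
  assume "is_ideal I"
  then interpret ideal I "ring_of_type_algebra :: 'r ring" .
  show "0 \<in> I \<and> (\<forall>x\<in>I. \<forall>y\<in>I. x + y \<in> I) \<and> (\<forall>x\<in>I. \<forall>r. r * x \<in> I)"
    using additive_subgroup.zero_closed[OF is_additive_subgroup]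
      additive_subgroup.a_closed[OF is_additive_subgroup] I_l_closed
    by simp
next
  assume *: "0 \<in> I \<and> (\<forall>x\<in>I. \<forall>y\<in>I. x + y \<in> I) \<and> (\<forall>x\<in>I. \<forall>r. r * x \<in> I)"
  interpret R: cring "ring_of_type_algebra :: 'r ring"
    by (rule cring_from_type_algebra)
  have uminus: "- x \<in> I" if "x \<in> I" for x
    using * that by (metis mult_minus1)
  have inv: "inv\<^bsub>add_monoid (ring_of_type_algebra :: 'r ring)\<^esub> x = - x" for x
    using R.minus_equality[of "- x" x] by (simp add: a_inv_def)
  show "is_ideal I"
  proof (rule idealI)
    show "ring (ring_of_type_algebra :: 'r ring)"
      by (rule ring_from_type_algebra)
    show "subgroup I (add_monoid ring_of_type_algebra)"
      using * uminus inv by (auto simp: subgroup_def)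
  qed (use * in \<open>auto simp: ring_of_type_algebra_def mult.commute\<close>)
qed

lemma is_ideal_0: "is_ideal I \<Longrightarrow> 0 \<in> I"
  and is_ideal_add: "is_ideal I \<Longrightarrow> x \<in> I \<Longrightarrow> y \<in> I \<Longrightarrow> x + y \<in> I"
  and is_ideal_mult: "is_ideal I \<Longrightarrow> x \<in> I \<Longrightarrow> r * x \<in> I"
  by (simp_all add: is_ideal_iff)

lemma is_ideal_mult_right: "is_ideal I \<Longrightarrow> x \<in> I \<Longrightarrow> x * r \<in> I"
  by (metis is_ideal_mult mult.commute)

lemma is_ideal_uminus: "is_ideal I \<Longrightarrow> x \<in> I \<Longrightarrow> - x \<in> I"
  by (metis is_ideal_mult mult_minus1)

lemma is_ideal_diff: "is_ideal I \<Longrightarrow> x \<in> I \<Longrightarrow> y \<in> I \<Longrightarrow> x - y \<in> I"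
  using is_ideal_add[of I x "- y"] is_ideal_uminus by fastforce

lemma is_ideal_sum: "is_ideal I \<Longrightarrow> (\<And>a. a \<in> A \<Longrightarrow> f a \<in> I) \<Longrightarrow> sum f A \<in> I"
  by (induction A rule: infinite_finite_induct) (auto intro: is_ideal_0 is_ideal_add)

lemma is_ideal_UNIV: "is_ideal UNIV"
  by (simp add: is_ideal_iff)

lemma is_ideal_zero: "is_ideal {0}"
  by (simp add: is_ideal_iff)

lemma is_ideal_one_imp_UNIV: "is_ideal I \<Longrightarrow> 1 \<in> I \<Longrightarrow> I = UNIV"
  by (metis UNIV_eq_I is_ideal_mult mult.right_neutral)

lemma is_ideal_INT: "(\<And>i. i \<in> A \<Longrightarrow> is_ideal (J i)) \<Longrightarrow> is_ideal (\<Inter>i\<in>A. J i)"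
  by (auto simp: is_ideal_iff)

lemma is_ideal_colon: "is_ideal L \<Longrightarrow> is_ideal {h. h * g \<in> L}"
  by (auto simp: is_ideal_iff algebra_simps)

lemma is_ideal_gen: "is_ideal (ideal_gen A)"
proof -
  interpret cring "ring_of_type_algebra :: 'a ring"
    by (rule cring_from_type_algebra)
  show ?thesis
    by (rule genideal_ideal) simp
qed

lemma ideal_gen_superset: "A \<subseteq> ideal_gen A"
  by (auto simp: genideal_def)

lemma ideal_gen_minimal: "is_ideal I \<Longrightarrow> A \<subseteq> I \<Longrightarrow> ideal_gen A \<subseteq> I"
  by (auto simp: genideal_def)

lemma ideal_gen_mono: "A \<subseteq> B \<Longrightarrow> ideal_gen A \<subseteq> ideal_gen B"
  by (meson ideal_gen_minimal ideal_gen_superset is_ideal_gen order_trans)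

lemma ideal_pow_0: "ideal_pow I 0 = UNIV"
  by (simp add: nat_pow_def ideals_set_def)

lemma ideal_pow_Suc: "ideal_pow I (Suc n) = ideal_prod ring_of_type_algebra (ideal_pow I n) I"
  by (simp add: nat_pow_def ideals_set_def)

lemma is_ideal_ideal_pow: "is_ideal I \<Longrightarrow> is_ideal (ideal_pow I n)"
proof (induction n)
  case (Suc n)
  interpret cring "ring_of_type_algebra :: 'a ring"
    by (rule cring_from_type_algebra)
  show ?case
    using Suc ideal_prod_is_ideal by (auto simp: ideal_pow_Suc)
qed (simp add: ideal_pow_0 is_ideal_UNIV)

lemma ideal_pow_SucI: "a \<in> ideal_pow I n \<Longrightarrow> b \<in> I \<Longrightarrow> a * b \<in> ideal_pow I (Suc n)"
  using ideal_prod.prod[of a "ideal_pow I n" b I ring_of_type_algebra]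
  by (simp add: ideal_pow_Suc)

lemma ideal_pow_Suc_minimal:
  assumes "is_ideal J" "\<And>a b. a \<in> ideal_pow I n \<Longrightarrow> b \<in> I \<Longrightarrow> a * b \<in> J"
  shows "ideal_pow I (Suc n) \<subseteq> J"
proof
  fix x assume "x \<in> ideal_pow I (Suc n)"
  then have "x \<in> ideal_prod ring_of_type_algebra (ideal_pow I n) I"
    by (simp add: ideal_pow_Suc)
  then show "x \<in> J"
    by induction (use assms in \<open>auto simp: is_ideal_add\<close>)
qed

lemma ideal_pow_1: "is_ideal I \<Longrightarrow> ideal_pow I (Suc 0) = I"
  using ideal_pow_SucI[of 1 I 0] ideal_pow_Suc_minimal[of I I 0]
  by (auto simp: ideal_pow_0 is_ideal_mult)

lemma ideal_pow_add:
  assumes "is_ideal I" "a \<in> ideal_pow I m" "b \<in> ideal_pow I n"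
  shows "a * b \<in> ideal_pow I (m + n)"
proof -
  have "ideal_pow I n \<subseteq> {b. b * a \<in> ideal_pow I (m + n)}"
  proof (induction n)
    case 0
    then show ?case
      using assms by (simp add: ideal_pow_0 subset_iff is_ideal_mult is_ideal_ideal_pow)
  next
    case (Suc n)
    show ?case
    proof (rule ideal_pow_Suc_minimal)
      fix x y assume "x \<in> ideal_pow I n" "y \<in> I"
      then have "(x * a) * y \<in> ideal_pow I (Suc (m + n))"
        using Suc by (intro ideal_pow_SucI) auto
      then show "x * y \<in> {b. b * a \<in> ideal_pow I (m + Suc n)}"
        by (simp add: ac_simps)
    qed (use assms in \<open>auto intro!: is_ideal_colon is_ideal_ideal_pow\<close>)
  qed
  then show ?thesis
    using assms(3) by (auto simp: mult.commute)
qed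

lemma ideal_pow_antimono:
  assumes "is_ideal I" "m \<le> n"
  shows "ideal_pow I n \<subseteq> ideal_pow I m"
proof (rule lift_Suc_antimono_le[OF _ assms(2)])
  show "ideal_pow I (Suc k) \<subseteq> ideal_pow I k" for k
    by (intro ideal_pow_Suc_minimal is_ideal_ideal_pow assms is_ideal_mult_right)
qed

lemma ideal_pow_power:
  assumes "is_ideal I" "a \<in> ideal_pow I m"
  shows "a ^ n \<in> ideal_pow I (m * n)"
  by (induction n) (use assms ideal_pow_add in \<open>auto simp: ideal_pow_0\<close>)

lemma ideal_pow_mono:
  assumes "is_ideal J" "I \<subseteq> J"
  shows "ideal_pow I n \<subseteq> ideal_pow J n"
proof (induction n)
  case (Suc n)
  then show ?case
    by (intro ideal_pow_Suc_minimal is_ideal_ideal_pow ideal_pow_SucI assms) (use assms in auto)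
qed (simp add: ideal_pow_0)

lemma ideal_pow_ideal_pow:
  assumes "is_ideal I"
  shows "ideal_pow (ideal_pow I m) n \<subseteq> ideal_pow I (m * n)"
proof (induction n)
  case (Suc n)
  then show ?case
    by (intro ideal_pow_Suc_minimal is_ideal_ideal_pow assms)
      (use ideal_pow_add[OF assms, of _ "m * n" _ m] in \<open>auto simp: add.commute\<close>)
qed (simp add: ideal_pow_0)

section \<open>Prime ideals, saturation and symbolic powers without fractions\<close>

lemma is_prime_ideal_iff:
  "is_prime_ideal P \<longleftrightarrow> is_ideal P \<and> 1 \<notin> P \<and> (\<forall>a b. a * b \<in> P \<longrightarrow> a \<in> P \<or> b \<in> P)"
  for P :: "'r::comm_ring_1 set"
proof
  assume "is_prime_ideal P"
  then interpret primeideal P "ring_of_type_algebra :: 'r ring" .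
  show "is_ideal P \<and> 1 \<notin> P \<and> (\<forall>a b. a * b \<in> P \<longrightarrow> a \<in> P \<or> b \<in> P)"
    using is_ideal I_notcarr I_prime is_ideal_one_imp_UNIV[OF is_ideal]
    by auto
next
  assume *: "is_ideal P \<and> 1 \<notin> P \<and> (\<forall>a b. a * b \<in> P \<longrightarrow> a \<in> P \<or> b \<in> P)"
  show "is_prime_ideal P"
    by (rule primeidealI) (use * in \<open>auto simp: cring_from_type_algebra\<close>)
qed

lemma is_prime_ideal_imp_is_ideal: "is_prime_ideal P \<Longrightarrow> is_ideal P"
  by (simp add: is_prime_ideal_iff)

lemma is_prime_ideal_mult_notin:
  "is_prime_ideal P \<Longrightarrow> a \<notin> P \<Longrightarrow> b \<notin> P \<Longrightarrow> a * b \<notin> P"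
  by (auto simp: is_prime_ideal_iff)

lemma is_prime_ideal_power_notin: "is_prime_ideal P \<Longrightarrow> a \<notin> P \<Longrightarrow> a ^ n \<notin> P"
  by (induction n) (auto simp: is_prime_ideal_iff)

lemma is_prime_ideal_zero: "is_prime_ideal {0 :: 'r::idom}"
  by (simp add: is_prime_ideal_iff is_ideal_zero)

text \<open>For a prime \<open>P\<close> of a domain this is the contraction of the extension of
  \<open>J\<close> to the localization at \<open>P\<close>. With a power of \<open>P\<close> as
  \<open>J\<close> it is a symbolic power.\<close>

definition saturation :: "'r::comm_ring_1 set \<Rightarrow> 'r set \<Rightarrow> 'r set" where
  "saturation P J = {f. \<exists>s. s \<notin> P \<and> s * f \<in> J}"

lemma is_ideal_saturation:
  assumes "is_prime_ideal P" "is_ideal J"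
  shows "is_ideal (saturation P J)"
proof -
  have "x + y \<in> saturation P J" if "s \<notin> P" "s * x \<in> J" "t \<notin> P" "t * y \<in> J" for s t x y
  proof -
    have "(s * t) * (x + y) = t * (s * x) + s * (t * y)"
      by (simp add: algebra_simps)
    then have "(s * t) * (x + y) \<in> J"
      using that assms by (simp add: is_ideal_add is_ideal_mult)
    then show ?thesis
      using that is_prime_ideal_mult_notin[OF assms(1)] by (auto simp: saturation_def)
  qed
  moreover have "r * x \<in> saturation P J" if "s \<notin> P" "s * x \<in> J" for r s x
    using that is_ideal_mult[OF assms(2), of "s * x" r] by (auto simp: saturation_def ac_simps)
  ultimately show ?thesis
    using assms by (auto simp: is_ideal_iff is_prime_ideal_iff)
      (auto simp: saturation_def)
qed

lemma subset_saturation: "is_prime_ideal P \<Longrightarrow> J \<subseteq> saturation P J"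
  by (force simp: saturation_def is_prime_ideal_iff)

lemma mem_saturation_cancel:
  assumes "is_prime_ideal P" "s \<notin> P" "s * f \<in> saturation P J"
  shows "f \<in> saturation P J"
  using assms is_prime_ideal_mult_notin[OF assms(1)]
  by (fastforce simp: saturation_def simp flip: mult.assoc)

lemma saturation_mult:
  assumes "is_prime_ideal P" "a \<in> saturation P J" "b \<in> saturation P K"
    "\<And>x y. x \<in> J \<Longrightarrow> y \<in> K \<Longrightarrow> x * y \<in> L"
  shows "a * b \<in> saturation P L"
proof -
  obtain s t where "s \<notin> P" "s * a \<in> J" "t \<notin> P" "t * b \<in> K"
    using assms by (auto simp: saturation_def)
  then have "s * t \<notin> P" "(s * t) * (a * b) \<in> L"
    using assms(4)[of "s * a" "t * b"] is_prime_ideal_mult_notin[OF assms(1)]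
    by (auto simp: ac_simps)
  then show ?thesis
    by (auto simp: saturation_def)
qed

context
  fixes P :: "'r::idom set"
  assumes P: "is_prime_ideal P"
begin

lemma localization_simps:
  "carrier (localization P) = {Fract a b | a b. b \<notin> P}"
  "monoid.mult (localization P) = (*)" "one (localization P) = 1"
  "zero (localization P) = 0" "add (localization P) = (+)"
  by (simp_all add: localization_def ring_of_type_algebra_def)

private lemma notin_imp_nz: "b \<notin> P \<Longrightarrow> b \<noteq> 0"
  using P by (auto simp: is_prime_ideal_iff is_ideal_iff)

private lemma Fract_in_localization: "b \<notin> P \<Longrightarrow> Fract a b \<in> carrier (localization P)"
  by (auto simp: localization_simps)

private lemma Fract_uminus_add: "b \<notin> P \<Longrightarrow> Fract (- a) b + Fract a b = 0"
  using notin_imp_nz by (simp flip: minus_fract)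

lemma localization_cring: "cring (localization P)"
proof (rule cringI)
  show "abelian_group (localization P)"
  proof (rule abelian_groupI)
    show "\<zero>\<^bsub>localization P\<^esub> \<in> carrier (localization P)"
      using P by (auto simp: localization_simps is_prime_ideal_iff rat_zero_code Zero_fract_def)
    fix x y assume x: "x \<in> carrier (localization P)" and y: "y \<in> carrier (localization P)"
    then obtain a b c d where *: "x = Fract a b" "b \<notin> P" "y = Fract c d" "d \<notin> P"
      by (auto simp: localization_simps)
    then show "x \<oplus>\<^bsub>localization P\<^esub> y \<in> carrier (localization P)"
      using is_prime_ideal_mult_notin[OF P] notin_imp_nz by (auto simp: localization_simps)
    have "Fract (-a) b \<in> carrier (localization P)" "Fract (-a) b + x = 0"
      using * Fract_in_localization Fract_uminus_add by blast+
    then show "\<exists>y\<in>carrier (localization P). y \<oplus>\<^bsub>localization P\<^esub> x = \<zero>\<^bsub>localization P\<^esub>"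
      by (auto simp: localization_simps)
  qed (auto simp: localization_simps ac_simps)
  show "comm_monoid (localization P)"
  proof (rule comm_monoidI)
    show "\<one>\<^bsub>localization P\<^esub> \<in> carrier (localization P)"
      using P by (auto simp: localization_simps is_prime_ideal_iff One_fract_def)
    fix x y assume "x \<in> carrier (localization P)" "y \<in> carrier (localization P)"
    then show "x \<otimes>\<^bsub>localization P\<^esub> y \<in> carrier (localization P)"
      using is_prime_ideal_mult_notin[OF P] by (auto simp: localization_simps) blast
  qed (auto simp: localization_simps ac_simps)
qed (auto simp: localization_simps algebra_simps)

text \<open>The fractions with numerator in \<open>J\<close> and denominator outside
  \<open>P\<close> already form an ideal of the localization, so the generated ideal contains
  nothing else. Conversely f is recovered from s f by the factor 1/s. Later arguments only need
  \<open>saturation\<close>.\<close>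

lemma symbolic_power_eq:
  "symbolic_power P l = (if l \<le> 0 then UNIV else saturation P (ideal_pow P (nat l)))"
proof (cases "l \<le> 0")
  case False
  interpret L: cring "localization P"
    by (rule localization_cring)
  define J where "J = ideal_pow P (nat l)"
  have J: "is_ideal J"
    using P by (simp add: J_def is_ideal_ideal_pow is_prime_ideal_iff)
  define T where "T = {Fract a b | a b. a \<in> J \<and> b \<notin> P}"
  have T: "ideal T (localization P)"
  proof (rule idealI)
    show "ring (localization P)" ..
    show "subgroup T (add_monoid (localization P))"
    proof
      show "T \<subseteq> carrier (add_monoid (localization P))"
        by (auto simp: T_def localization_simps)
      show "\<one>\<^bsub>add_monoid (localization P)\<^esub> \<in> T"
        using P J by (auto simp: T_def localization_simps is_prime_ideal_iff Zero_fract_def is_ideal_iff)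
      fix x assume "x \<in> T"
      then obtain a b where x: "x = Fract a b" "a \<in> J" "b \<notin> P"
        by (auto simp: T_def)
      have "Fract (-a) b \<in> carrier (localization P)" "Fract (-a) b + x = 0" "x \<in> carrier (localization P)"
        using x Fract_in_localization Fract_uminus_add by blast+
      then have "\<ominus>\<^bsub>localization P\<^esub> x = Fract (-a) b"
        using L.minus_equality[of "Fract (-a) b" x] by (simp add: localization_simps)
      moreover have "Fract (-a) b \<in> T"
        using x is_ideal_uminus[OF J] unfolding T_def by blast
      ultimately show "inv\<^bsub>add_monoid (localization P)\<^esub> x \<in> T"
        by (simp add: a_inv_def)
      fix y assume "y \<in> T"
      then obtain c d where y: "y = Fract c d" "c \<in> J" "d \<notin> P"
        by (auto simp: T_def)
      have "x + y = Fract (d * a + b * c) (b * d)"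
        using x y notin_imp_nz by (simp add: ac_simps)
      then show "x \<otimes>\<^bsub>add_monoid (localization P)\<^esub> y \<in> T"
        using x y J is_prime_ideal_mult_notin[OF P]
        by (auto simp: T_def localization_simps intro!: exI is_ideal_add is_ideal_mult)
    qed
    fix x y assume "x \<in> T" "y \<in> carrier (localization P)"
    then obtain a b c d where "x = Fract a b" "a \<in> J" "b \<notin> P" "y = Fract c d" "d \<notin> P"
      by (auto simp: T_def localization_simps)
    then have "x * y \<in> T"
      using J is_prime_ideal_mult_notin[OF P] by (auto simp: T_def intro!: exI is_ideal_mult_right)
    then show "x \<otimes>\<^bsub>localization P\<^esub> y \<in> T" "y \<otimes>\<^bsub>localization P\<^esub> x \<in> T"
      by (auto simp: localization_simps mult.commute)
  qed
  have "f \<in> saturation P J" if "Fract f 1 \<in> genideal (localization P) ((\<lambda>g. Fract g 1) ` J)" for f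
  proof -
    have "(\<lambda>g. Fract g 1) ` J \<subseteq> T"
      using P by (auto simp: T_def is_prime_ideal_iff)
    then have "Fract f 1 \<in> T"
      using that T by (auto simp: genideal_def)
    then obtain a b where "Fract f 1 = Fract a b" "a \<in> J" "b \<notin> P"
      by (auto simp: T_def)
    then show ?thesis
      using notin_imp_nz by (auto simp: saturation_def eq_fract mult.commute intro!: exI[of _ b])
  qed
  moreover have "Fract f 1 \<in> genideal (localization P) ((\<lambda>g. Fract g 1) ` J)"
    if "f \<in> saturation P J" for f
  proof -
    obtain s where s: "s \<notin> P" "s * f \<in> J"
      using \<open>f \<in> saturation P J\<close> by (auto simp: saturation_def)
    have "Fract f 1 \<in> U" if U: "ideal U (localization P)" "(\<lambda>g. Fract g 1) ` J \<subseteq> U" for U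
    proof -
      have "Fract (s * f) 1 \<in> U" "Fract 1 s \<in> carrier (localization P)"
        using U s by (auto simp: localization_simps)
      then have "Fract 1 s * Fract (s * f) 1 \<in> U"
        using ideal.I_l_closed[OF U(1)] by (metis localization_simps(2))
      moreover have "Fract 1 s * Fract (s * f) 1 = Fract f 1"
        using s notin_imp_nz by (simp add: eq_fract)
      ultimately show ?thesis
        by simp
    qed
    then show ?thesis
      by (auto simp: genideal_def)
  qed
  ultimately show ?thesis
    using False by (auto simp: symbolic_power_def J_def)
qed (simp add: symbolic_power_def)

lemma is_ideal_symbolic_power: "is_ideal (symbolic_power P l)"
  using P by (auto simp: symbolic_power_eq is_ideal_UNIV is_ideal_saturation is_ideal_ideal_pow
      is_prime_ideal_imp_is_ideal)

lemma symbolic_power_antimono: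
  assumes "k \<le> l"
  shows "symbolic_power P l \<subseteq> symbolic_power P k"
proof -
  have "ideal_pow P (nat l) \<subseteq> ideal_pow P (nat k)"
    using assms P by (intro ideal_pow_antimono) (auto simp: is_prime_ideal_imp_is_ideal)
  then show ?thesis
    using assms by (auto simp: symbolic_power_eq saturation_def)
qed

lemma symbolic_power_mult:
  assumes "f \<in> symbolic_power P k" "g \<in> symbolic_power P l"
  shows "f * g \<in> symbolic_power P (k + l)"
proof (cases "k > 0 \<and> l > 0")
  case True
  then show ?thesis
    using assms ideal_pow_add[OF is_prime_ideal_imp_is_ideal[OF P]]
    by (auto simp: symbolic_power_eq nat_add_distrib intro: saturation_mult[OF P])
next
  case False
  \<comment> \<open>An exponent that is not positive imposes no condition, and then the sum is at
    most the other exponent, so the other factor alone suffices.\<close>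
  then consider "k + l \<le> k" | "k + l \<le> l"
    by linarith
  then show ?thesis
  proof cases
    case 1
    then show ?thesis
      using symbolic_power_antimono[of "k + l" k] assms is_ideal_mult_right[OF is_ideal_symbolic_power]
      by blast
  next
    case 2
    then show ?thesis
      using symbolic_power_antimono[of "k + l" l] assms is_ideal_mult[OF is_ideal_symbolic_power]
      by blast
  qed
qed

lemma symbolic_power_power:
  assumes "f \<in> symbolic_power P k"
  shows "f ^ n \<in> symbolic_power P (int n * k)"
proof (induction n)
  case (Suc n)
  then show ?case
    using symbolic_power_mult[OF assms Suc] by (simp add: algebra_simps)
qed (simp add: symbolic_power_eq)

end

section \<open>Frobenius powers and roots\<close>

abbreviation lookup where "lookup \<equiv> Poly_Mapping.lookup"
abbreviation keys where "keys \<equiv> Poly_Mapping.keys"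
abbreviation single where "single \<equiv> Poly_Mapping.single"

section \<open>Powers of finitely generated ideals and the pigeonhole argument\<close>

lemma ideal_pow_ideal_gen:
  fixes G :: "'r::comm_ring_1 set"
  assumes "finite G"
  shows "ideal_pow (ideal_gen G) n \<subseteq> ideal_gen {\<Prod>g\<in>G. g ^ u g | u. sum u G = n}"
proof (induction n)
  case 0
  have "(\<Prod>g\<in>G. g ^ (0::nat)) \<in> {\<Prod>g\<in>G. g ^ u g | u. sum u G = 0}"
    by (force intro: exI[of _ "\<lambda>_. 0"])
  then have "1 \<in> ideal_gen {\<Prod>g\<in>G. g ^ u g | u. sum u G = 0}"
    using ideal_gen_superset by fastforce
  then show ?case
    using is_ideal_one_imp_UNIV[OF is_ideal_gen] by blast
next
  case (Suc n)
  define M where "M n = {\<Prod>g\<in>G. g ^ u g | u. sum u G = n}" for n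
  have M: "m * h \<in> M (Suc n)" if m: "m \<in> M n" and h: "h \<in> G" for m h
  proof -
    obtain u where u: "m = (\<Prod>g\<in>G. g ^ u g)" "sum u G = n"
      using m by (auto simp: M_def)
    have "m * h = (\<Prod>g\<in>G. g ^ (u(h := Suc (u h))) g)"
      using assms h unfolding u(1)
      by (subst (1 2) prod.remove[of G h]) (auto simp: ac_simps intro!: prod.cong)
    moreover have "sum (u(h := Suc (u h))) G = Suc n"
      using assms h unfolding u(2)[symmetric]
      by (subst (1 2) sum.remove[of G h]) (auto intro!: sum.cong)
    ultimately show ?thesis
      by (force simp: M_def)
  qed
  show ?case
    unfolding M_def[symmetric]
  proof (rule ideal_pow_Suc_minimal[OF is_ideal_gen])
    fix a b assume a: "a \<in> ideal_pow (ideal_gen G) n" and b: "b \<in> ideal_gen G"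
    define T where "T = ideal_gen (M (Suc n))"
    have T: "is_ideal T"
      by (simp add: T_def is_ideal_gen)
    \<comment> \<open>Membership of a product in \<open>T\<close> is linear in each factor, so it
      can be tested on generators, one factor at a time, through a colon ideal for each.\<close>
    have "ideal_gen (M n) \<subseteq> {a. a * h \<in> T}" if "h \<in> G" for h
    proof (rule ideal_gen_minimal[OF is_ideal_colon[OF T]])
      show "M n \<subseteq> {a. a * h \<in> T}"
        using M[OF _ that] ideal_gen_superset[of "M (Suc n)"] by (auto simp: T_def)
    qed
    then have "G \<subseteq> {h. h * a \<in> T}"
      using a Suc by (auto simp: M_def mult.commute)
    then have "ideal_gen G \<subseteq> {h. h * a \<in> T}"
      by (rule ideal_gen_minimal[OF is_ideal_colon[OF T]])
    then show "a * b \<in> ideal_gen (M (Suc n))"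
      using b by (auto simp: mult.commute T_def)
  qed
qed

lemma frobenius_power_ideal: "is_ideal (frobenius_power q L)"
  by (simp add: frobenius_power_def is_ideal_gen)

lemma power_in_frobenius_power: "g \<in> L \<Longrightarrow> g ^ q \<in> frobenius_power q L"
  using ideal_gen_superset by (force simp: frobenius_power_def)

lemma frobenius_power_minimal:
  "is_ideal J \<Longrightarrow> (\<And>g. g \<in> L \<Longrightarrow> g ^ q \<in> J) \<Longrightarrow> frobenius_power q L \<subseteq> J"
  unfolding frobenius_power_def by (rule ideal_gen_minimal) auto

lemma frobenius_power_mono: "L \<subseteq> M \<Longrightarrow> frobenius_power q L \<subseteq> frobenius_power q M"
  unfolding frobenius_power_def by (intro ideal_gen_mono image_mono)

lemma frobenius_power_UNIV: "frobenius_power q UNIV = UNIV"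
  using power_in_frobenius_power[of 1 UNIV q]
  by (intro is_ideal_one_imp_UNIV frobenius_power_ideal) simp

text \<open>Among \<open>n\<close> factors from \<open>card G\<close> generators one finds \<open>m\<close> disjoint blocks of \<open>q\<close> equal ones.\<close>

lemma ideal_pow_subset_frobenius_power:
  fixes G :: "'r::comm_ring_1 set"
  assumes "finite G" "q > 0" and n: "q * m + card G * (q - 1) < n + q"
  shows "ideal_pow (ideal_gen G) n \<subseteq> frobenius_power q (ideal_pow (ideal_gen G) m)"
proof -
  have "{\<Prod>g\<in>G. g ^ u g | u. sum u G = n} \<subseteq> frobenius_power q (ideal_pow (ideal_gen G) m)"
  proof safe
    fix u :: "'r \<Rightarrow> nat"
    assume u: "n = sum u G"
    have "sum u G = (\<Sum>g\<in>G. q * (u g div q) + u g mod q)"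
      by simp
    also have "\<dots> \<le> (\<Sum>g\<in>G. q * (u g div q) + (q - 1))"
      using assms(2) by (intro sum_mono add_left_mono) (simp add: Suc_leI le_diff_conv2 flip: less_Suc_eq_le)
    also have "\<dots> = q * (\<Sum>g\<in>G. u g div q) + card G * (q - 1)"
      by (simp add: sum.distrib sum_distrib_left)
    \<comment> \<open>The hypothesis with \<open>n + q\<close> on the right is the sharp bound q(m -
      1) + card G (q - 1) + 1 <= n. It leaves one multiple of q to spare, hence the
      \<open>+ 1\<close> here.\<close>
    finally have "q * m < q * ((\<Sum>g\<in>G. u g div q) + 1)"
      using n u by simp
    then have m: "m \<le> (\<Sum>g\<in>G. u g div q)"
      unfolding mult_less_cancel1 by simp
    have "(\<Prod>g\<in>H. g ^ (u g div q)) \<in> ideal_pow (ideal_gen G) (\<Sum>g\<in>H. u g div q)" if "H \<subseteq> G" for H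
      using finite_subset[OF that assms(1)] that
    proof (induction H rule: finite_induct)
      case (insert h H)
      have "h \<in> ideal_pow (ideal_gen G) 1"
        using insert ideal_gen_superset by (auto simp: ideal_pow_1 is_ideal_gen)
      then have "h ^ (u h div q) \<in> ideal_pow (ideal_gen G) (u h div q)"
        using ideal_pow_power[OF is_ideal_gen] by fastforce
      then show ?case
        using insert by (auto intro: ideal_pow_add is_ideal_gen)
    qed (simp add: ideal_pow_0)
    then have "(\<Prod>g\<in>G. g ^ (u g div q)) \<in> ideal_pow (ideal_gen G) m"
      using ideal_pow_antimono[OF is_ideal_gen m] by blast
    then have "(\<Prod>g\<in>G. g ^ (u g div q)) ^ q * (\<Prod>g\<in>G. g ^ (u g mod q)) \<in>
        frobenius_power q (ideal_pow (ideal_gen G) m)"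
      by (intro is_ideal_mult_right frobenius_power_ideal power_in_frobenius_power)
    also have "(\<Prod>g\<in>G. g ^ (u g div q)) ^ q * (\<Prod>g\<in>G. g ^ (u g mod q)) = (\<Prod>g\<in>G. g ^ u g)"
      by (simp add: prod_power_distrib prod.distrib[symmetric] power_mult[symmetric]
          power_add[symmetric])
    finally show "(\<Prod>g\<in>G. g ^ u g) \<in> frobenius_power q (ideal_pow (ideal_gen G) m)" .
  qed
  then show ?thesis
    using ideal_pow_ideal_gen[OF assms(1), of n] ideal_gen_minimal[OF frobenius_power_ideal] by blast
qed

section \<open>Cartier maps, that is, linear maps from the Frobenius pushforward of the ring to the
  ring\<close>

definition cartier :: "nat \<Rightarrow> ('r::comm_ring_1 \<Rightarrow> 'r) \<Rightarrow> bool" where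
  "cartier q \<phi> \<longleftrightarrow> (\<forall>f g. \<phi> (f + g) = \<phi> f + \<phi> g) \<and> (\<forall>f g. \<phi> (g ^ q * f) = g * \<phi> f)"

lemma cartier_add: "cartier q \<phi> \<Longrightarrow> \<phi> (f + g) = \<phi> f + \<phi> g"
  and cartier_mult: "cartier q \<phi> \<Longrightarrow> \<phi> (g ^ q * f) = g * \<phi> f"
  by (auto simp: cartier_def)

lemma cartier_frobenius_power:
  assumes "cartier q \<phi>" "is_ideal L" "f \<in> frobenius_power q L"
  shows "\<phi> f \<in> L"
proof -
  have [simp]: "\<phi> 0 = 0"
    using cartier_add[OF assms(1), of 0 0] by simp
  \<comment> \<open>The preimage of \<open>L\<close> under \<phi> need not be an ideal, as \<phi> is
    linear over q-th powers only. Quantifying over all multiples of \<open>f\<close> makes it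
    one.\<close>
  have "is_ideal {f. \<forall>r. \<phi> (r * f) \<in> L}"
    unfolding is_ideal_iff
  proof (intro conjI ballI allI)
    fix x r assume "x \<in> {f. \<forall>r. \<phi> (r * f) \<in> L}"
    then show "r * x \<in> {f. \<forall>r. \<phi> (r * f) \<in> L}"
      by (auto simp flip: mult.assoc)
  qed (use assms in \<open>auto simp: cartier_add distrib_left is_ideal_0 is_ideal_add\<close>)
  moreover have "\<phi> (r * g ^ q) \<in> L" if "g \<in> L" for g r
    using that assms by (metis cartier_mult mult.commute is_ideal_mult_right)
  ultimately have "frobenius_power q L \<subseteq> {f. \<forall>r. \<phi> (r * f) \<in> L}"
    by (intro frobenius_power_minimal) auto
  then have "\<phi> (1 * f) \<in> L"
    using assms(3) by blast
  then show ?thesis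
    by simp
qed

text \<open>The field is a vector space over itself by \<open>c ^ q * d\<close>; \<open>\<rho> b\<close> is the coordinate at the
  basis vector \<open>b\<close>.\<close>

lemma frobenius_coordinates:
  assumes p: "prime CHAR('a::field)" and q: "q = CHAR('a::field) ^ e"
  obtains \<rho> :: "'a::field \<Rightarrow> 'a::field \<Rightarrow> 'a::field" where
    "\<And>b c d. \<rho> b (c + d) = \<rho> b c + \<rho> b d"
    "\<And>b c d. \<rho> b (c ^ q * d) = c * \<rho> b d"
    "\<And>c. finite {b. \<rho> b c \<noteq> 0}"
    "\<And>c. (\<Sum>b | \<rho> b c \<noteq> 0. \<rho> b c ^ q * b) = c"
proof -
  interpret V: vector_space "\<lambda>c d :: 'a. c ^ q * d"
    using freshmans_dream'[OF p q]
    by unfold_locales (auto simp: algebra_simps power_mult_distrib)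
  \<comment> \<open>Any basis will do. It may be infinite, since the field need not be finite over
    its q-th powers.\<close>
  define B where "B = V.extend_basis {}"
  have B: "V.independent B" "V.span B = UNIV"
    unfolding B_def by (simp_all add: V.independent_extend_basis V.span_extend_basis V.independent_empty)
  show thesis
  proof
    fix c :: 'a
    show "finite {b. V.representation B c b \<noteq> 0}"
      by (rule V.finite_representation)
    show "(\<Sum>b | V.representation B c b \<noteq> 0. V.representation B c b ^ q * b) = c"
      using B by (intro V.sum_nonzero_representation_eq) auto
  qed (use B in \<open>auto simp: V.representation_add V.representation_scale\<close>)
qed

definition monom_of :: "('n::finite \<Rightarrow> nat) \<Rightarrow> 'n monom" where
  "monom_of = Abs_poly_mapping"

lemma lookup_monom_of [simp]: "lookup (monom_of h) = h"
  by (simp add: monom_of_def)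

definition monom_scale :: "nat \<Rightarrow> 'n::finite monom \<Rightarrow> 'n monom" where
  "monom_scale q m = monom_of (\<lambda>i. q * lookup m i)"

lemma lookup_monom_scale [simp]: "lookup (monom_scale q m) i = q * lookup m i"
  by (simp add: monom_scale_def)

lemma monom_scale_add: "monom_scale q (m + m') = monom_scale q m + monom_scale q m'"
  by (simp add: poly_mapping_eq_iff fun_eq_iff lookup_add algebra_simps)

lemma monom_scale_Suc: "monom_scale (Suc n) m = m + monom_scale n m"
  by (simp add: poly_mapping_eq_iff fun_eq_iff lookup_add)

lemma monom_scale_0 [simp]: "monom_scale 0 m = 0" "monom_scale n 0 = 0"
  by (simp_all add: poly_mapping_eq_iff fun_eq_iff)

lemma monom_scale_inject [simp]: "q > 0 \<Longrightarrow> monom_scale q m = monom_scale q m' \<longleftrightarrow> m = m'"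
  by (auto simp: poly_mapping_eq_iff fun_eq_iff)

lemma lookup_single_mult_add:
  fixes f :: "'m::cancel_comm_monoid_add \<Rightarrow>\<^sub>0 'a::semiring_0"
  shows "lookup (single a c * f) (a + j) = c * lookup f j"
proof -
  have "lookup (single a c * f) (a + j) =
      (\<Sum>l. (c * (\<Sum>k. lookup f k when a + j = l + k)) when l = a)"
    unfolding lookup_mult by (intro Sum_any.cong) (auto simp: lookup_single when_def)
  then show ?thesis
    by simp
qed

lemma lookup_single_mult_eq_0:
  fixes f :: "'m::cancel_comm_monoid_add \<Rightarrow>\<^sub>0 'a::semiring_0"
  assumes "\<And>j. k \<noteq> a + j"
  shows "lookup (single a c * f) k = 0"
proof -
  have "k \<notin> keys (single a c * f)"
    using keys_mult[of "single a c" f] assms by (auto split: if_splits)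
  then show ?thesis
    by (simp add: in_keys_iff)
qed

lemma poly_mapping_sum_single: "f = (\<Sum>m\<in>keys f. single m (lookup f m))"
proof (rule poly_mapping_eqI)
  fix k
  have "(\<Sum>m\<in>keys f. lookup (single m (lookup f m)) k) = (\<Sum>m\<in>keys f. if m = k then lookup f m else 0)"
    by (intro sum.cong) (auto simp: lookup_single)
  then show "lookup f k = lookup (\<Sum>m\<in>keys f. single m (lookup f m)) k"
    by (auto simp: lookup_sum in_keys_iff)
qed

lemma CHAR_poly_mapping: "CHAR('m::comm_monoid_add \<Rightarrow>\<^sub>0 'a::comm_semiring_1) = CHAR('a)"
proof (rule CHAR_eqI)
  have "of_nat n = (0 :: 'm \<Rightarrow>\<^sub>0 'a) \<longleftrightarrow> of_nat n = (0 :: 'a)" for n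
  proof -
    have "(of_nat n :: 'm \<Rightarrow>\<^sub>0 'a) = single 0 (of_nat n)"
      by simp
    also have "\<dots> = 0 \<longleftrightarrow> of_nat n = (0 :: 'a)"
      using lookup_single_eq[of "0 :: 'm" "of_nat n :: 'a"] by (auto simp del: lookup_single_eq single_of_nat)
    finally show ?thesis .
  qed
  then show "of_nat CHAR('a) = (0 :: 'm \<Rightarrow>\<^sub>0 'a)"
    and "\<And>n. of_nat n = (0 :: 'm \<Rightarrow>\<^sub>0 'a) \<Longrightarrow> CHAR('a) dvd n"
    by (simp_all add: of_nat_eq_0_iff_char_dvd)
qed

lemma power_single:
  fixes c :: "'a::comm_semiring_1"
  shows "single (m :: 'n::finite monom) c ^ n = single (monom_scale n m) (c ^ n)"
  by (induction n) (auto simp: mult_single monom_scale_Suc)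

lemma constant_ideal_UNIV:
  fixes L :: "('n::{finite,linorder}, 'a::field) mpoly set"
  assumes "is_ideal L" "single 0 c \<in> L" "c \<noteq> 0"
  shows "L = UNIV"
proof (rule is_ideal_one_imp_UNIV[OF assms(1)])
  have "single 0 (inverse c) * single 0 c \<in> L"
    using assms by (intro is_ideal_mult)
  then show "1 \<in> L"
    using assms by (simp add: mult_single)
qed

context
  fixes e q :: nat
  assumes prime_char: "prime CHAR('a::field)"
    and q_eq: "q = CHAR('a) ^ e"
begin

private lemma q_pos: "q > 0"
  using prime_char prime_gt_0_nat by (simp add: q_eq)

lemma frobenius_sum:
  fixes f :: "('n::{finite,linorder}, 'a) mpoly"
  shows "f ^ q = (\<Sum>m\<in>keys f. single (monom_scale q m) (lookup f m ^ q))"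
proof -
  have "f ^ q = (\<Sum>m\<in>keys f. single m (lookup f m)) ^ q"
    using poly_mapping_sum_single[of f] by simp
  also have "\<dots> = (\<Sum>m\<in>keys f. single m (lookup f m) ^ q)"
    by (rule freshmans_dream_sum') (use prime_char q_eq in \<open>auto simp: CHAR_poly_mapping\<close>)
  finally show ?thesis
    by (simp add: power_single)
qed

lemma lookup_frobenius_monom_scale:
  fixes f :: "('n::{finite,linorder}, 'a) mpoly"
  shows "lookup (f ^ q) (monom_scale q m) = lookup f m ^ q"
proof -
  have "lookup (f ^ q) (monom_scale q m) = (\<Sum>m'\<in>keys f. if m' = m then lookup f m' ^ q else 0)"
    unfolding frobenius_sum lookup_sum
    by (intro sum.cong) (auto simp: lookup_single q_pos when_def)
  then show ?thesis
    using q_pos by (auto simp: in_keys_iff)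
qed

lemma lookup_frobenius_eq_0:
  fixes f :: "('n::{finite,linorder}, 'a) mpoly"
  assumes "\<And>m'. m \<noteq> monom_scale q m'"
  shows "lookup (f ^ q) m = 0"
  unfolding frobenius_sum lookup_sum
  using assms by (intro sum.neutral) (auto simp: lookup_single when_def)

text \<open>Over its q-th powers the ring has a basis of products of a field element
  \<open>b\<close> and a monomial with exponent vector \<open>u\<close> below q in every variable.
  If \<rho> is the coordinate at \<open>b\<close>, this is the coordinate of \<open>f\<close> at
  that product.\<close>

definition cartier_map :: "('a \<Rightarrow> 'a) \<Rightarrow> 'n monom \<Rightarrow> ('n::{finite,linorder}, 'a) mpoly \<Rightarrow> ('n, 'a) mpoly" where
  "cartier_map \<rho> u f = Abs_poly_mapping (\<lambda>w. \<rho> (lookup f (monom_scale q w + u)))"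

lemma lookup_cartier_map:
  assumes "\<rho> 0 = 0"
  shows "lookup (cartier_map \<rho> u f) w = \<rho> (lookup f (monom_scale q w + u))"
proof -
  have "{w. \<rho> (lookup f (monom_scale q w + u)) \<noteq> 0} \<subseteq> (\<lambda>w. monom_scale q w + u) -` keys f"
    using assms by (auto simp: in_keys_iff)
  moreover have "inj (\<lambda>w. monom_scale q w + u)"
    using q_pos by (auto simp: inj_def)
  ultimately have "finite {w. \<rho> (lookup f (monom_scale q w + u)) \<noteq> 0}"
    by (meson finite_keys finite_subset finite_vimageI)
  then show ?thesis
    by (simp add: cartier_map_def)
qed

lemma cartier_cartier_map:
  fixes u :: "'n::{finite,linorder} monom"
  assumes add: "\<And>c d. \<rho> (c + d) = \<rho> c + \<rho> d" and mult: "\<And>c d. \<rho> (c ^ q * d) = c * \<rho> d"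
    and u: "\<And>i. lookup u i < q"
  shows "cartier q (cartier_map \<rho> u)"
proof -
  have [simp]: "\<rho> 0 = 0"
    using add[of 0 0] by (metis add_0 add_cancel_right_left)
  have Add: "cartier_map \<rho> u (f + g) = cartier_map \<rho> u f + cartier_map \<rho> u g" for f g
    by (rule poly_mapping_eqI) (simp add: lookup_cartier_map lookup_add add)
  have Zero: "cartier_map \<rho> u 0 = 0"
    using Add[of 0 0] by (metis add_0 add_cancel_right_left)
  have Single: "cartier_map \<rho> u (single (monom_scale q v) (c ^ q) * f) = single v c * cartier_map \<rho> u f"
    for v c f
  proof (rule poly_mapping_eqI)
    fix w
    show "lookup (cartier_map \<rho> u (single (monom_scale q v) (c ^ q) * f)) w =
        lookup (single v c * cartier_map \<rho> u f) w"
    proof (cases "\<exists>j. w = v + j")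
      case True
      then obtain j where w: "w = v + j" ..
      have *: "monom_scale q w + u = monom_scale q v + (monom_scale q j + u)"
        by (simp add: w monom_scale_add ac_simps)
      show ?thesis
        unfolding lookup_cartier_map[of \<rho>, OF \<open>\<rho> 0 = 0\<close>] * lookup_single_mult_add mult
        by (simp add: w lookup_single_mult_add lookup_cartier_map)
    next
      case False
      have "monom_scale q w + u \<noteq> monom_scale q v + j" for j
      proof
        assume *: "monom_scale q w + u = monom_scale q v + j"
        \<comment> \<open>This is where the bound on \<open>u\<close> enters: as the entry of
          \<open>u\<close> is below q, a divisibility by the q-fold of \<open>v\<close> is already
          visible on the q-fold of \<open>w\<close>.\<close>
        have "lookup v i \<le> lookup w i" for i
        proof -
          have "q * lookup v i \<le> q * lookup w i + lookup u i"
            using arg_cong[OF *, of "\<lambda>m. lookup m i"] by (simp add: lookup_add)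
          also have "\<dots> < q * (lookup w i + 1)"
            using u[of i] by simp
          finally show ?thesis
            unfolding mult_less_cancel1 by simp
        qed
        then have "w = v + (w - v)"
          by (auto intro!: poly_mapping_eqI simp: lookup_add lookup_minus)
        then show False
          using False by blast
      qed
      then show ?thesis
        using False by (simp add: lookup_cartier_map lookup_single_mult_eq_0)
    qed
  qed
  have "cartier_map \<rho> u (g ^ q * f) = g * cartier_map \<rho> u f" for f g
  proof -
    have sum: "cartier_map \<rho> u (sum h A) = (\<Sum>a\<in>A. cartier_map \<rho> u (h a))" for h and A :: "'n monom set"
      by (induction A rule: infinite_finite_induct) (auto simp: Add Zero)
    have "cartier_map \<rho> u (g ^ q * f) = (\<Sum>m\<in>keys g. single m (lookup g m)) * cartier_map \<rho> u f"
      by (simp add: frobenius_sum sum_distrib_right sum Single)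
    then show ?thesis
      using poly_mapping_sum_single[of g] by simp
  qed
  then show ?thesis
    by (simp add: cartier_def Add)
qed

text \<open>For the direction that constructs membership, \<open>f\<close> is the sum of the basis
  elements times the q-th powers of its coordinates. If all coordinates lie in \<open>L\<close>,
  every summand lies in the Frobenius power.\<close>

lemma frobenius_power_iff_cartier:
  fixes L :: "('n::{finite,linorder}, 'a) mpoly set"
  assumes L: "is_ideal L"
  shows "f \<in> frobenius_power q L \<longleftrightarrow> (\<forall>\<phi>. cartier q \<phi> \<longrightarrow> \<phi> f \<in> L)"
proof
  assume *: "\<forall>\<phi>. cartier q \<phi> \<longrightarrow> \<phi> f \<in> L"
  obtain \<rho> :: "'a \<Rightarrow> 'a \<Rightarrow> 'a" where \<rho>:
    "\<And>b c d. \<rho> b (c + d) = \<rho> b c + \<rho> b d"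
    "\<And>b c d. \<rho> b (c ^ q * d) = c * \<rho> b d"
    "\<And>c. finite {b. \<rho> b c \<noteq> 0}"
    "\<And>c. (\<Sum>b | \<rho> b c \<noteq> 0. \<rho> b c ^ q * b) = c"
    using frobenius_coordinates[OF prime_char q_eq] by blast
  have [simp]: "\<rho> b 0 = 0" for b
    using \<rho>(1)[of b 0 0] by (metis add_0 add_cancel_right_left)
  \<comment> \<open>Collecting only the basis elements that occur in coefficients of
    \<open>f\<close> keeps the expansion finite.\<close>
  define B where "B = (\<Union>m\<in>keys f. {b. \<rho> b (lookup f m) \<noteq> 0})"
  define r where "r m = monom_of (\<lambda>i. lookup m i mod q)" for m :: "'n monom"
  define d where "d m = monom_of (\<lambda>i. lookup m i div q)" for m :: "'n monom"
  define U where "U = r ` keys f"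
  have fin: "finite B" "finite U"
    using \<rho>(3) by (auto simp: B_def U_def)
  have U: "lookup u i < q" if "u \<in> U" for u i
    using that q_pos by (auto simp: U_def r_def)
  have coord: "lookup (single u b * cartier_map (\<rho> b) u f ^ q) m =
      (if u = r m then \<rho> b (lookup f m) ^ q * b else 0)" if u: "u \<in> U" for u b m
  proof (cases "u = r m")
    case True
    have m: "m = u + monom_scale q (d m)"
      by (rule poly_mapping_eqI) (simp add: True r_def d_def lookup_add)
    have "lookup (single u b * cartier_map (\<rho> b) u f ^ q) (u + monom_scale q (d m)) =
        b * \<rho> b (lookup f (u + monom_scale q (d m))) ^ q"
      by (simp add: lookup_single_mult_add lookup_frobenius_monom_scale lookup_cartier_map add.commute)
    then show ?thesis
      using True m by (simp add: mult.commute)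
  next
    case False
    show ?thesis
    proof (cases "\<exists>j. m = u + j")
      case True
      then obtain j where j: "m = u + j" ..
      have "j \<noteq> monom_scale q w" for w
      proof
        assume "j = monom_scale q w"
        then have "u = r m"
          using U[OF u] by (auto intro!: poly_mapping_eqI simp: r_def j lookup_add)
        with False show False ..
      qed
      then show ?thesis
        using False by (simp add: j lookup_single_mult_add lookup_frobenius_eq_0)
    qed (use False in \<open>simp add: lookup_single_mult_eq_0\<close>)
  qed
  have "f = (\<Sum>b\<in>B. \<Sum>u\<in>U. single u b * cartier_map (\<rho> b) u f ^ q)"
  proof (rule poly_mapping_eqI)
    fix m
    have "lookup (\<Sum>b\<in>B. \<Sum>u\<in>U. single u b * cartier_map (\<rho> b) u f ^ q) m =
        (\<Sum>b\<in>B. \<Sum>u\<in>U. if u = r m then \<rho> b (lookup f m) ^ q * b else 0)"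
      by (simp add: lookup_sum coord)
    also have "\<dots> = (\<Sum>b\<in>B. if r m \<in> U then \<rho> b (lookup f m) ^ q * b else 0)"
      using fin by simp
    also have "\<dots> = (\<Sum>b\<in>B. \<rho> b (lookup f m) ^ q * b)"
      using q_pos by (intro sum.cong) (auto simp: U_def in_keys_iff image_iff)
    also have "\<dots> = (\<Sum>b | \<rho> b (lookup f m) \<noteq> 0. \<rho> b (lookup f m) ^ q * b)"
    proof (rule sum.mono_neutral_right)
      have "b \<in> B" if b: "\<rho> b (lookup f m) \<noteq> 0" for b
      proof -
        have "m \<in> keys f"
          using b \<open>\<And>b. \<rho> b 0 = 0\<close>[of b] by (auto simp: in_keys_iff simp del: \<open>\<And>b. \<rho> b 0 = 0\<close>)
        with b show ?thesis
          unfolding B_def by (intro UN_I[of m]) simp_all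
      qed
      then show "{b. \<rho> b (lookup f m) \<noteq> 0} \<subseteq> B"
        by blast
    qed (use fin q_pos in auto)
    finally show "lookup f m = lookup (\<Sum>b\<in>B. \<Sum>u\<in>U. single u b * cartier_map (\<rho> b) u f ^ q) m"
      by (simp add: \<rho>(4))
  qed
  moreover have "single u b * cartier_map (\<rho> b) u f ^ q \<in> frobenius_power q L" if "u \<in> U" for u b
    using * cartier_cartier_map[of "\<rho> b", OF \<rho>(1,2) U[OF that]]
    by (intro is_ideal_mult frobenius_power_ideal power_in_frobenius_power) auto
  ultimately show "f \<in> frobenius_power q L"
    by (metis (no_types, lifting) is_ideal_sum frobenius_power_ideal)
qed (use cartier_frobenius_power[OF _ L] in blast)

text \<open>Projection to the residue class of \<open>u\<close> modulo q leaves a constant, because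
  no other exponent of \<open>f\<close> lies in that class. Some basis element of the field detects
  the constant, since the coordinates of a nonzero element do not all vanish.\<close>

lemma cartier_to_constant:
  fixes f :: "('n::{finite,linorder}, 'a) mpoly"
  assumes u: "\<And>i. lookup u i < q" "lookup f u \<noteq> 0"
    and only: "\<And>w. monom_scale q w + u \<in> keys f \<Longrightarrow> w = 0"
  obtains \<phi> c where "cartier q \<phi>" "\<phi> f = single 0 c" "c \<noteq> 0"
proof -
  obtain \<rho> :: "'a \<Rightarrow> 'a \<Rightarrow> 'a" where \<rho>:
    "\<And>b c d. \<rho> b (c + d) = \<rho> b c + \<rho> b d"
    "\<And>b c d. \<rho> b (c ^ q * d) = c * \<rho> b d"
    "\<And>c. finite {b. \<rho> b c \<noteq> 0}"
    "\<And>c. (\<Sum>b | \<rho> b c \<noteq> 0. \<rho> b c ^ q * b) = c"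
    using frobenius_coordinates[OF prime_char q_eq] by blast
  have [simp]: "\<rho> b 0 = 0" for b
    using \<rho>(1)[of b 0 0] by (metis add_0 add_cancel_right_left)
  obtain b where b: "\<rho> b (lookup f u) \<noteq> 0"
    using \<rho>(4)[of "lookup f u"] u(2) by (metis (mono_tags, lifting) mem_Collect_eq sum.empty equals0I)
  have "cartier_map (\<rho> b) u f = single 0 (\<rho> b (lookup f u))"
  proof (rule poly_mapping_eqI)
    fix w
    have "lookup f (monom_scale q w + u) = 0" if "w \<noteq> 0"
      using only[of w] that by (meson in_keys_iff)
    then show "lookup (cartier_map (\<rho> b) u f) w = lookup (single 0 (\<rho> b (lookup f u))) w"
      by (cases "w = 0") (auto simp: lookup_cartier_map lookup_single)
  qed
  then show thesis
    using that cartier_cartier_map[of "\<rho> b", OF \<rho>(1,2) u(1)] b by blast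
qed

text \<open>Flatness of Frobenius in the form \<phi>(h g^q) = g \<phi>(h), which holds for every
  Cartier map \<phi>.\<close>

lemma frobenius_power_colon:
  fixes L :: "('n::{finite,linorder}, 'a) mpoly set"
  assumes L: "is_ideal L" and h: "h * g ^ q \<in> frobenius_power q L"
  shows "h \<in> frobenius_power q {x. x * g \<in> L}"
proof -
  have "\<phi> h * g \<in> L" if \<phi>: "cartier q \<phi>" for \<phi>
    using cartier_frobenius_power[OF \<phi> L h] cartier_mult[OF \<phi>, of g h] by (simp add: mult.commute)
  then show ?thesis
    by (simp add: frobenius_power_iff_cartier[OF is_ideal_colon[OF L]])
qed

text \<open>A Cartier map that sends \<open>h\<close> to a nonzero constant forces the colon ideal
  of \<open>g\<close> to be the whole ring. The multiplier \<open>h\<close> will be the one of the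
  tight closure argument as well as F^(q-1).\<close>

lemma frobenius_power_cancel:
  fixes L :: "('n::{finite,linorder}, 'a) mpoly set"
  assumes L: "is_ideal L" and h: "h * g ^ q \<in> frobenius_power q L"
    and u: "\<And>i. lookup u i < q" "lookup h u \<noteq> 0"
    and only: "\<And>w. monom_scale q w + u \<in> keys h \<Longrightarrow> w = 0"
  shows "g \<in> L"
proof -
  obtain \<phi> c where \<phi>: "cartier q \<phi>" "\<phi> h = single 0 c" "c \<noteq> 0"
    using cartier_to_constant[OF u only] by blast
  have "single 0 c \<in> {x. x * g \<in> L}"
    using cartier_frobenius_power[OF \<phi>(1) is_ideal_colon[OF L] frobenius_power_colon[OF L h]] \<phi>
    by simp
  then have "{x. x * g \<in> L} = UNIV"
    using constant_ideal_UNIV[OF is_ideal_colon[OF L]] \<phi> by blast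
  then show ?thesis
    by (metis (no_types, lifting) UNIV_I mem_Collect_eq mult_1)
qed

lemma frobenius_power_power_iff:
  fixes L :: "('n::{finite,linorder}, 'a) mpoly set"
  assumes "is_ideal L" "f ^ q \<in> frobenius_power q L"
  shows "f \<in> L"
proof (rule frobenius_power_cancel[OF assms(1), of 1 _ 0])
  fix w :: "'n monom"
  assume "monom_scale q w + 0 \<in> keys (1 :: ('n, 'a) mpoly)"
  then have "monom_scale q w = monom_scale q 0"
    by simp
  then show "w = 0"
    using q_pos by (simp only: monom_scale_inject)
qed (use assms q_pos in auto)

text \<open>\<open>LEAST\<close> presupposes that a smallest ideal exists. The images under Cartier
  maps generate it: every admissible ideal must contain them, and by the membership test they
  suffice.\<close>

lemma frobenius_root_eq:
  fixes J :: "('n::{finite,linorder}, 'a) mpoly set"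
  shows "frobenius_root q J = ideal_gen {\<phi> f | \<phi> f. cartier q \<phi> \<and> f \<in> J}"
    (is "_ = ideal_gen ?G")
  unfolding frobenius_root_def
proof (rule Least_equality)
  have "f \<in> frobenius_power q (ideal_gen ?G)" if "f \<in> J" for f
    using that ideal_gen_superset[of ?G] unfolding frobenius_power_iff_cartier[OF is_ideal_gen] by blast
  then show "is_ideal (ideal_gen ?G) \<and> J \<subseteq> frobenius_power q (ideal_gen ?G)"
    by (auto simp: is_ideal_gen)
next
  fix L :: "('n, 'a) mpoly set"
  assume L: "is_ideal L \<and> J \<subseteq> frobenius_power q L"
  have "?G \<subseteq> L"
  proof safe
    fix \<phi> :: "('n, 'a) mpoly \<Rightarrow> ('n, 'a) mpoly" and f
    assume "cartier q \<phi>" "f \<in> J"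
    then show "\<phi> f \<in> L"
      using L cartier_frobenius_power[of q \<phi> L f] by (meson subsetD)
  qed
  then show "ideal_gen ?G \<subseteq> L"
    using L by (intro ideal_gen_minimal) auto
qed

lemma frobenius_root_ideal:
  fixes J :: "('n::{finite,linorder}, 'a) mpoly set"
  shows "is_ideal (frobenius_root q J)"
  by (simp add: frobenius_root_eq is_ideal_gen)

lemma subset_frobenius_power_root:
  fixes J :: "('n::{finite,linorder}, 'a) mpoly set"
  shows "J \<subseteq> frobenius_power q (frobenius_root q J)"
proof
  fix f assume "f \<in> J"
  show "f \<in> frobenius_power q (frobenius_root q J)"
    unfolding frobenius_power_iff_cartier[OF frobenius_root_ideal]
  proof (intro allI impI)
    fix \<phi> :: "('n, 'a) mpoly \<Rightarrow> ('n, 'a) mpoly"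
    assume "cartier q \<phi>"
    then show "\<phi> f \<in> frobenius_root q J"
      unfolding frobenius_root_eq
      by (intro subsetD[OF ideal_gen_superset]) (use \<open>f \<in> J\<close> in blast)
  qed
qed

lemma frobenius_root_minimal:
  fixes J :: "('n::{finite,linorder}, 'a) mpoly set"
  assumes "is_ideal L" "J \<subseteq> frobenius_power q L"
  shows "frobenius_root q J \<subseteq> L"
  unfolding frobenius_root_eq
proof (intro ideal_gen_minimal assms subsetI, elim CollectE exE conjE)
  fix x and \<phi> :: "('n, 'a) mpoly \<Rightarrow> ('n, 'a) mpoly" and f
  assume "x = \<phi> f" "cartier q \<phi>" "f \<in> J"
  then show "x \<in> L"
    using assms cartier_frobenius_power[of q \<phi> L f] by (metis subsetD)
qed

lemma frobenius_power_Inter: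
  fixes L :: "'i \<Rightarrow> ('n::{finite,linorder}, 'a) mpoly set"
  assumes "\<And>i. is_ideal (L i)" "\<And>i. f \<in> frobenius_power q (L i)"
  shows "f \<in> frobenius_power q (\<Inter>i. L i)"
  using assms by (simp add: frobenius_power_iff_cartier is_ideal_INT)

end

section \<open>Term orders and integral closure\<close>

lemma nat_sequence_incseq_subsequence:
  fixes f :: "nat \<Rightarrow> nat"
  obtains r where "strict_mono r" "incseq (f \<circ> r)"
proof -
  obtain r where r: "strict_mono r" "monoseq (\<lambda>n. f (r n))"
    using seq_monosub[of f] by blast
  show thesis
  proof (cases "incseq (f \<circ> r)")
    case False
    then have dec: "decseq (f \<circ> r)"
      using r(2) by (auto simp: monoseq_iff comp_def)
    \<comment> \<open>A decreasing sequence of naturals is constant from the place of its minimum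
      on.\<close>
    obtain k where k: "\<And>n. (f \<circ> r) k \<le> (f \<circ> r) n"
      using ex_has_least_nat[of "\<lambda>_. True" 0 "f \<circ> r"] by auto
    have "(f \<circ> r) (k + n) = (f \<circ> r) k" for n
      using k[of "k + n"] decseqD[OF dec, of k "k + n"] by simp
    then have "incseq (f \<circ> (\<lambda>n. r (k + n)))"
      by (simp add: incseq_def)
    moreover have "strict_mono (\<lambda>n. r (k + n))"
      using r(1) by (simp add: strict_mono_def)
    ultimately show thesis
      using that by blast
  qed (use r that in blast)
qed

text \<open>A subsequence that is monotone in some of the variables is refined to be monotone in one
  more; as there are finitely many variables, this ends.\<close>

lemma dickson_sequence:
  fixes f :: "nat \<Rightarrow> 'n::finite monom"
  obtains i j where "i < j" "\<And>x. lookup (f i) x \<le> lookup (f j) x"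
proof -
  have "\<exists>r. strict_mono r \<and> (\<forall>x\<in>A. incseq (\<lambda>n. lookup (f (r n)) x))" if "finite A" for A
    using that
  proof (induction A rule: finite_induct)
    case empty
    then show ?case
      using strict_mono_id by blast
  next
    case (insert x A)
    then obtain r where r: "strict_mono r" "\<And>y. y \<in> A \<Longrightarrow> incseq (\<lambda>n. lookup (f (r n)) y)"
      by blast
    obtain s where s: "strict_mono s" "incseq ((\<lambda>n. lookup (f (r n)) x) \<circ> s)"
      using nat_sequence_incseq_subsequence .
    have "incseq (\<lambda>n. lookup (f ((r \<circ> s) n)) y)" if "y \<in> insert x A" for y
      using that s r(2) by (auto simp: incseq_def comp_def strict_mono_less_eq)
    then show ?case
      using strict_mono_o[OF r(1) s(1)] by blast
  qed
  from this[OF finite_class.finite_UNIV]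
  obtain r where r: "strict_mono r" "\<And>x. incseq (\<lambda>n. lookup (f (r n)) x)"
    by blast
  show thesis
  proof (rule that)
    show "r 0 < r 1"
      using r(1) by (simp add: strict_mono_def)
    show "lookup (f (r 0)) x \<le> lookup (f (r 1)) x" for x
      using r(2)[of x] by (simp add: incseq_def)
  qed
qed

lemma monom_le_imp_add:
  fixes m m' :: "'n monom"
  assumes "\<And>x. lookup m x \<le> lookup m' x"
  shows "m' = m + (m' - m)"
proof (rule poly_mapping_eqI)
  fix k
  show "lookup m' k = lookup (m + (m' - m)) k"
    using assms[of k] by (simp add: lookup_add lookup_minus)
qed

text \<open>The minimal elements of \<open>M\<close> are pairwise incomparable under divisibility,
  so an infinite set of them would contradict the statement on sequences.\<close>

lemma dickson:
  fixes M :: "'n::finite monom set"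
  obtains N where "finite N" "N \<subseteq> M" "\<And>m. m \<in> M \<Longrightarrow> \<exists>n\<in>N. \<forall>x. lookup n x \<le> lookup m x"
proof
  define N where "N = {m \<in> M. \<forall>m'\<in>M. (\<forall>x. lookup m' x \<le> lookup m x) \<longrightarrow> m' = m}"
  show "finite N"
  proof (rule ccontr)
    assume "infinite N"
    then obtain f :: "nat \<Rightarrow> 'n monom" where f: "inj f" "range f \<subseteq> N"
      using infinite_countable_subset by blast
    obtain i j where ij: "i < j" "\<And>x. lookup (f i) x \<le> lookup (f j) x"
      using dickson_sequence[of f] by blast
    moreover have "f i \<in> N" "f j \<in> N"
      using f(2) by auto
    ultimately have "f i = f j"
      by (auto simp: N_def)
    with f(1) ij(1) show False
      by (simp add: inj_eq)
  qed
  show "N \<subseteq> M"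
    by (auto simp: N_def)
  fix m assume m: "m \<in> M"
  \<comment> \<open>Proper division lowers the total degree, so a divisor of \<open>m\<close> in
    \<open>M\<close> of least total degree is minimal in \<open>M\<close>.\<close>
  define deg where "deg m = (\<Sum>x\<in>UNIV. lookup m x)" for m :: "'n monom"
  obtain n where n: "n \<in> M" "\<And>x. lookup n x \<le> lookup m x"
    and least: "\<And>n'. n' \<in> M \<Longrightarrow> (\<forall>x. lookup n' x \<le> lookup m x) \<Longrightarrow> deg n \<le> deg n'"
    using ex_has_least_nat[of "\<lambda>n. n \<in> M \<and> (\<forall>x. lookup n x \<le> lookup m x)" m deg] m by auto
  have "n' = n" if "n' \<in> M" and le: "\<And>x. lookup n' x \<le> lookup n x" for n'
  proof (rule ccontr)
    assume "n' \<noteq> n"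
    then obtain y where "lookup n' y \<noteq> lookup n y"
      by (meson poly_mapping_eqI)
    then have "lookup n' y < lookup n y"
      using le[of y] by simp
    then have "deg n' < deg n"
      unfolding deg_def by (intro sum_strict_mono_ex1) (use le in auto)
    moreover have "deg n \<le> deg n'"
      using least[OF that(1)] le n(2) order_trans by blast
    ultimately show False
      by simp
  qed
  then have "n \<in> N"
    using n(1) by (auto simp: N_def)
  then show "\<exists>n\<in>N. \<forall>x. lookup n x \<le> lookup m x"
    using n(2) by blast
qed

section \<open>Term orders, leading monomials and Hilbert's basis theorem\<close>

context
  fixes ord :: "'n::{finite,linorder} monom rel"
  assumes ord: "term_order ord"
begin

lemma term_order_refl: "(m, m) \<in> ord"
  using ord by (auto simp: term_order_def linear_order_on_def partial_order_on_def preorder_on_def refl_on_def)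

lemma term_order_trans: "(l, m) \<in> ord \<Longrightarrow> (m, n) \<in> ord \<Longrightarrow> (l, n) \<in> ord"
  using ord by (auto simp: term_order_def linear_order_on_def partial_order_on_def preorder_on_def
      elim: transE)

lemma term_order_antisym: "(l, m) \<in> ord \<Longrightarrow> (m, l) \<in> ord \<Longrightarrow> l = m"
  using ord by (auto simp: term_order_def linear_order_on_def partial_order_on_def elim: antisymD)

lemma term_order_total: "(l, m) \<in> ord \<or> (m, l) \<in> ord"
  using ord term_order_refl
  by (cases "l = m") (auto simp: term_order_def linear_order_on_def total_on_def)

lemma term_order_add_right: "(m, m') \<in> ord \<Longrightarrow> (m + u, m' + u) \<in> ord"
  using ord by (auto simp: term_order_def)

lemma term_order_add_mono: "(l, l') \<in> ord \<Longrightarrow> (m, m') \<in> ord \<Longrightarrow> (l + m, l' + m') \<in> ord"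
  by (metis term_order_add_right term_order_trans add.commute)

lemma term_order_add_self: "(m, m + u) \<in> ord"
  using ord term_order_add_right[of 0 u m] by (simp add: term_order_def add.commute)

lemma term_order_dvd:
  assumes "\<And>x. lookup m x \<le> lookup m' x"
  shows "(m, m') \<in> ord"
  using term_order_add_self[of m "m' - m"] monom_le_imp_add[OF assms] by simp

text \<open>In an infinite descending chain some entry divides a later one by Dickson's lemma and
  thus lies below it in the order, against the descent.\<close>

lemma wf_term_order: "wf (ord - Id)"
  unfolding wf_iff_no_infinite_down_chain
proof
  assume "\<exists>f. \<forall>i. (f (Suc i), f i) \<in> ord - Id"
  then obtain f where f: "\<And>i. (f (Suc i), f i) \<in> ord - Id"
    by blast
  have desc: "(f (i + k), f i) \<in> ord" for i k
  proof (induction k)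
    case (Suc k)
    then show ?case
      using f[of "i + k"] by (auto intro: term_order_trans)
  qed (simp add: term_order_refl)
  obtain i j where ij: "i < j" "\<And>x. lookup (f i) x \<le> lookup (f j) x"
    using dickson_sequence[of f] by blast
  obtain k where "j = Suc i + k"
    using ij(1) less_iff_Suc_add by auto
  then have "(f i, f (Suc i)) \<in> ord"
    using desc[of "Suc i" k] term_order_dvd[OF ij(2)] term_order_trans by metis
  then show False
    using f[of i] term_order_antisym by blast
qed

lemma term_order_finite_max:
  assumes "finite A" "A \<noteq> {}"
  obtains m where "m \<in> A" "\<And>m'. m' \<in> A \<Longrightarrow> (m', m) \<in> ord"
proof -
  have "\<exists>m\<in>A. \<forall>m'\<in>A. (m', m) \<in> ord"
    using assms
  proof (induction A rule: finite_ne_induct)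
    case (singleton x)
    then show ?case
      by (auto simp: term_order_refl)
  next
    case (insert x A)
    then obtain m where m: "m \<in> A" "\<And>m'. m' \<in> A \<Longrightarrow> (m', m) \<in> ord"
      by blast
    show ?case
    proof (cases "(x, m) \<in> ord")
      case False
      then have "(m, x) \<in> ord"
        using term_order_total by blast
      then show ?thesis
        using m term_order_trans term_order_refl by blast
    qed (use m in blast)
  qed
  then show thesis
    using that by blast
qed

text \<open>A relation in place of \<open>initial_monom\<close>, whose definite description is
  unspecified at the zero polynomial.\<close>

definition leading :: "'n monom \<Rightarrow> ('n, 'a::zero) mpoly \<Rightarrow> bool" where
  "leading m f \<longleftrightarrow> m \<in> keys f \<and> (\<forall>m'\<in>keys f. (m', m) \<in> ord)"

lemma leading_exists:
  assumes "f \<noteq> 0"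
  obtains m where "leading m f"
proof -
  have "keys f \<noteq> {}"
    using assms by (metis equals0D lookup_zero not_in_keys_iff_lookup_eq_zero poly_mapping_eqI)
  then obtain m where "m \<in> keys f" "\<And>m'. m' \<in> keys f \<Longrightarrow> (m', m) \<in> ord"
    using term_order_finite_max[of "keys f"] by auto
  then show thesis
    using that by (auto simp: leading_def)
qed

lemma leading_initial_monom:
  assumes "f \<noteq> 0"
  shows "leading (initial_monom ord f) f"
proof -
  obtain m where m: "leading m f"
    using leading_exists[OF assms] .
  have "initial_monom ord f = m"
    unfolding initial_monom_def
    using m term_order_antisym by (intro the_equality) (auto simp: leading_def)
  with m show ?thesis
    by simp
qed

text \<open>Exponents of the factors can add up to m + n only as m and n themselves. These are mere
  upper bounds and need not occur, so vanishing coefficients require no separate treatment and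
  powers follow by induction.\<close>

lemma lookup_leading_mult:
  fixes f g :: "('n, 'a::comm_semiring_1) mpoly"
  assumes f: "\<forall>a\<in>keys f. (a, m) \<in> ord" and g: "\<forall>b\<in>keys g. (b, n) \<in> ord"
  shows "\<forall>a\<in>keys (f * g). (a, m + n) \<in> ord"
    and "lookup (f * g) (m + n) = lookup f m * lookup g n"
proof -
  show "\<forall>a\<in>keys (f * g). (a, m + n) \<in> ord"
    using keys_mult[of f g] f g term_order_add_mono by blast
  have "lookup (single a (lookup f a) * g) (m + n) = (if a = m then lookup f m * lookup g n else 0)"
    if "a \<in> keys f" for a
  proof (cases "a = m")
    case True
    then show ?thesis
      by (simp add: lookup_single_mult_add)
  next
    case False
    show ?thesis
    proof (cases "\<exists>j. m + n = a + j")
      case True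
      then obtain j where j: "m + n = a + j" ..
      have "j \<notin> keys g"
      proof
        assume "j \<in> keys g"
        then have "(m + j, m + n) \<in> ord" "(a + j, m + j) \<in> ord" "(a + j, a + n) \<in> ord" "(a + n, m + n) \<in> ord"
          using f g that by (auto intro: term_order_add_mono term_order_refl)
        then have "m + n = m + j"
          unfolding j using term_order_antisym by blast
        with False j show False
          by simp
      qed
      then show ?thesis
        using False by (simp add: j lookup_single_mult_add in_keys_iff)
    qed (use False in \<open>simp add: lookup_single_mult_eq_0\<close>)
  qed
  then have "lookup (\<Sum>a\<in>keys f. single a (lookup f a) * g) (m + n) =
      (\<Sum>a\<in>keys f. if a = m then lookup f m * lookup g n else 0)"
    unfolding lookup_sum by (intro sum.cong) auto
  also have "\<dots> = lookup f m * lookup g n"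
    by (simp add: in_keys_iff)
  finally show "lookup (f * g) (m + n) = lookup f m * lookup g n"
    using poly_mapping_sum_single[of f] by (simp flip: sum_distrib_right)
qed

lemma lookup_leading_power:
  fixes f :: "('n, 'a::comm_semiring_1) mpoly"
  assumes "\<forall>a\<in>keys f. (a, m) \<in> ord"
  shows "(\<forall>a\<in>keys (f ^ k). (a, monom_scale k m) \<in> ord) \<and>
    lookup (f ^ k) (monom_scale k m) = lookup f m ^ k"
proof (induction k)
  case 0
  then show ?case
    by (simp add: term_order_refl)
next
  case (Suc k)
  then show ?case
    using lookup_leading_mult[OF assms, of "f ^ k" "monom_scale k m"]
    by (simp add: monom_scale_Suc)
qed

text \<open>The generators form a Groebner basis: by Dickson's lemma finitely many members have
  leading monomials that divide all others, and reduction by them stops because the term order is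
  well-founded. Their number becomes the constant in the theorem of Briancon and Skoda.\<close>

theorem ideal_finitely_generated:
  fixes I :: "('n, 'a::field) mpoly set"
  assumes I: "is_ideal I"
  obtains G where "finite G" "I = ideal_gen G"
proof -
  define M where "M = {m. \<exists>f\<in>I. leading m f}"
  obtain N where N: "finite N" "N \<subseteq> M" "\<And>m. m \<in> M \<Longrightarrow> \<exists>n\<in>N. \<forall>x. lookup n x \<le> lookup m x"
    using dickson[of M] by metis
  have "\<forall>n\<in>N. \<exists>g\<in>I. leading n g"
    using N(2) by (auto simp: M_def)
  then obtain g where g: "\<And>n. n \<in> N \<Longrightarrow> g n \<in> I" "\<And>n. n \<in> N \<Longrightarrow> leading n (g n)"
    by metis
  define G where "G = g ` N"
  have "f \<in> ideal_gen G" if "f \<in> I" "leading m f" for f m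
    using that
  proof (induction m arbitrary: f rule: wf_induct_rule[OF wf_term_order])
    case (1 m)
    then obtain n where n: "n \<in> N" "\<And>x. lookup n x \<le> lookup m x"
      using N(3)[of m] by (auto simp: M_def)
    have m: "m = n + (m - n)"
      by (rule monom_le_imp_add[OF n(2)])
    define c where "c = lookup f m / lookup (g n) n"
    define h where "h = single (m - n) c * g n"
    have "lookup (g n) n \<noteq> 0"
      using g(2)[OF n(1)] by (simp add: leading_def in_keys_iff)
    moreover have keys_g: "\<forall>a\<in>keys (g n). (a, n) \<in> ord"
      using g(2)[OF n(1)] by (simp add: leading_def)
    moreover have keys_s: "\<forall>a\<in>keys (single (m - n) c). (a, m - n) \<in> ord"
      by (simp add: term_order_refl)
    ultimately have h: "\<forall>a\<in>keys h. (a, m) \<in> ord" "lookup h m = lookup f m"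
      using lookup_leading_mult[OF keys_s keys_g] m by (simp_all add: h_def c_def add.commute)
    have h_gen: "h \<in> ideal_gen G"
      unfolding h_def using ideal_gen_superset[of G] n(1)
      by (intro is_ideal_mult is_ideal_gen) (auto simp: G_def)
    have h_I: "h \<in> I"
      unfolding h_def by (intro is_ideal_mult I g n(1))
    have "f - h \<in> ideal_gen G"
    proof (cases "f - h = 0")
      case False
      then obtain l where l: "leading l (f - h)"
        using leading_exists by blast
      have "l \<in> keys f \<union> keys h"
        using l by (auto simp: leading_def in_keys_iff lookup_minus)
      then have "(l, m) \<in> ord"
        using 1(3) h(1) by (auto simp: leading_def)
      moreover have "l \<noteq> m"
        using l h(2) by (auto simp: leading_def in_keys_iff lookup_minus)
      ultimately show ?thesis
        using 1(1)[of l "f - h"] l is_ideal_diff[OF I 1(2) h_I] by blast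
    qed (simp add: is_ideal_0 is_ideal_gen)
    then have "(f - h) + h \<in> ideal_gen G"
      by (intro is_ideal_add is_ideal_gen h_gen)
    then show ?case
      by simp
  qed
  then have "I \<subseteq> ideal_gen G"
    using leading_exists is_ideal_0[OF is_ideal_gen] by (metis subsetI)
  moreover have "ideal_gen G \<subseteq> I"
    using g(1) by (intro ideal_gen_minimal I) (auto simp: G_def)
  ultimately show thesis
    using that[of G] N(1) by (auto simp: G_def)
qed

end

section \<open>Integral closure and the theorem of Briancon and Skoda\<close>

lemma subset_integral_closure:
  assumes "is_ideal J"
  shows "J \<subseteq> integral_closure J"
proof
  fix r assume "r \<in> J"
  then have "- r \<in> ideal_pow J (Suc 0)"
    using assms by (simp add: ideal_pow_1 is_ideal_uminus)
  then show "r \<in> integral_closure J"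
    unfolding integral_closure_def
    by (intro CollectI exI[of _ 1] exI[of _ "\<lambda>_. - r"]) auto
qed

text \<open>An element integral over \<open>J\<close> lies in the tight closure of \<open>J\<close> up to the loss of a
  bounded number of factors: all its powers \<open>g ^ m\<close> are multiplied into \<open>J ^ m\<close> by one element.\<close>

lemma integral_closure_multiplier:
  assumes J: "is_ideal J" and g: "g \<in> integral_closure J" and d: "d \<in> J"
  obtains n where "\<And>m. d ^ n * g ^ m \<in> ideal_pow J m"
proof -
  obtain n c where n: "n > 0" and c: "\<And>i. i \<in> {1..n} \<Longrightarrow> c i \<in> ideal_pow J i"
    and eq: "g ^ n + (\<Sum>i=1..n. c i * g ^ (n - i)) = 0"
    using g unfolding integral_closure_def by blast
  have "d ^ n * g ^ m \<in> ideal_pow J m" for m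
  proof (induction m rule: less_induct)
    case (less m)
    show ?case
    proof (cases "m \<le> n")
      case True
      \<comment> \<open>Up to \<open>n\<close> the multiplier alone is in a high enough power of
        \<open>J\<close>; the integral equation serves only beyond \<open>n\<close>.\<close>
      have "d ^ n \<in> ideal_pow J n"
        using ideal_pow_power[OF J, of d "Suc 0" n] d by (simp add: ideal_pow_1[OF J])
      then show ?thesis
        using ideal_pow_antimono[OF J True] by (intro is_ideal_mult_right is_ideal_ideal_pow J) auto
    next
      case False
      have "d ^ n * g ^ m = d ^ n * g ^ (m - n) * g ^ n"
        using False by (simp add: mult.assoc flip: power_add)
      also have "g ^ n = - (\<Sum>i=1..n. c i * g ^ (n - i))"
        using eq by (simp add: eq_neg_iff_add_eq_0)
      also have "d ^ n * g ^ (m - n) * \<dots> = - (\<Sum>i=1..n. c i * (d ^ n * (g ^ (m - n) * g ^ (n - i))))"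
        by (simp add: sum_distrib_left ac_simps)
      also have "\<dots> = - (\<Sum>i=1..n. c i * (d ^ n * g ^ (m - i)))"
        using False by (intro arg_cong[of _ _ uminus] sum.cong) (auto simp flip: power_add)
      also have "\<dots> \<in> ideal_pow J m"
      proof (intro is_ideal_uminus is_ideal_sum is_ideal_ideal_pow J)
        fix i assume i: "i \<in> {1..n}"
        then have "c i * (d ^ n * g ^ (m - i)) \<in> ideal_pow J (i + (m - i))"
          using False by (intro ideal_pow_add J c less) auto
        then show "c i * (d ^ n * g ^ (m - i)) \<in> ideal_pow J m"
          using i False by simp
      qed
      finally show ?thesis .
    qed
  qed
  then show thesis
    using that by blast
qed

text \<open>All coefficients of an integral equation over the zero ideal vanish. This settles the
  case in which the ideal offers no nonzero multiplier.\<close>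

lemma integral_closure_zero:
  fixes J :: "'r::idom set"
  assumes "J = {0}"
  shows "integral_closure J = {0}"
proof -
  have J: "is_ideal J"
    by (simp add: assms is_ideal_zero)
  have "g = 0" if g: "g \<in> integral_closure J" for g
  proof -
    obtain n c where n: "n > 0" and c: "\<And>i. i \<in> {1..n} \<Longrightarrow> c i \<in> ideal_pow J i"
      and eq: "g ^ n + (\<Sum>i=1..n. c i * g ^ (n - i)) = 0"
      using g unfolding integral_closure_def by blast
    have "c i = 0" if "i \<in> {1..n}" for i
      using c[OF that] ideal_pow_antimono[OF J, of "Suc 0" i] that assms
      unfolding ideal_pow_1[OF J] by auto
    then have "g ^ n = 0"
      using eq by simp
    then show ?thesis
      by simp
  qed
  then show ?thesis
    using subset_integral_closure[OF J] by (auto simp: assms)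
qed

text \<open>The tight closure argument: if
  \<open>c * g ^ q \<in> (I ^ s)\<^sup>[\<^sup>q\<^sup>]\<close> for all \<open>q\<close>, then \<open>c\<close> lies in all Frobenius powers of the
  colon ideal of \<open>g\<close>, which therefore cannot be proper.\<close>

lemma briancon_skoda:
  fixes G :: "('n::{finite,linorder}, 'a::field) mpoly set"
  assumes p: "prime CHAR('a)" and G: "finite G" and I: "I = ideal_gen G"
  shows "integral_closure (ideal_pow I (s + card G)) \<subseteq> ideal_pow I s"
proof
  fix g assume g: "g \<in> integral_closure (ideal_pow I (s + card G))"
  have idl: "is_ideal I"
    by (simp add: I is_ideal_gen)
  show "g \<in> ideal_pow I s"
  proof (cases "ideal_pow I (s + card G) = {0}")
    case True
    then show ?thesis
      using g integral_closure_zero[OF True] by (simp add: is_ideal_0 is_ideal_ideal_pow idl)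
  next
    case False
    then obtain d where d: "d \<in> ideal_pow I (s + card G)" "d \<noteq> 0"
      using is_ideal_0[OF is_ideal_ideal_pow[OF idl]] by blast
    obtain n where n: "\<And>m. d ^ n * g ^ m \<in> ideal_pow (ideal_pow I (s + card G)) m"
      using integral_closure_multiplier[OF is_ideal_ideal_pow[OF idl] g d(1)] by blast
    define c where "c = d ^ n"
    have "c \<noteq> 0"
      using d by (simp add: c_def)
    then obtain u where u: "lookup c u \<noteq> 0"
      by (metis lookup_zero poly_mapping_eqI)
    define D where "D = Max (\<Union>m\<in>keys c. range (lookup m))"
    have D: "lookup m i \<le> D" if "m \<in> keys c" for m i
      unfolding D_def using that by (intro Max_ge) auto
    \<comment> \<open>One q above all exponents occurring in \<open>c\<close> is enough: distinct
      exponents of \<open>c\<close> then lie in distinct residue classes modulo q.\<close>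
    obtain e where e: "D < CHAR('a) ^ e"
      using power_gt_expt[of "CHAR('a)" D] prime_gt_1_nat[OF p] by (metis One_nat_def less_trans linorder_neqE_nat)
    define q where "q = CHAR('a) ^ e"
    have q: "D < q" "q > 0"
      using e prime_gt_0_nat[OF p] by (auto simp: q_def)
    have "c * g ^ q \<in> ideal_pow I ((s + card G) * q)"
      using n[of q] ideal_pow_ideal_pow[OF idl] by (auto simp: c_def)
    moreover have "ideal_pow I ((s + card G) * q) \<subseteq> frobenius_power q (ideal_pow I s)"
      unfolding I
    proof (rule ideal_pow_subset_frobenius_power[OF G q(2)])
      \<comment> \<open>The extra \<open>card G\<close> in the exponent, multiplied by q, covers the
        pigeonhole loss of q - 1 per generator.\<close>
      have "card G * (q - 1) \<le> card G * q"
        by simp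
      then have "q * s + card G * (q - 1) < q * s + card G * q + q"
        using q(2) by linarith
      then show "q * s + card G * (q - 1) < (s + card G) * q + q"
        by (simp add: algebra_simps)
    qed
    ultimately have "c * g ^ q \<in> frobenius_power q (ideal_pow I s)"
      by blast
    then show ?thesis
    proof (rule frobenius_power_cancel[OF p q_def is_ideal_ideal_pow[OF idl]])
      show "lookup u i < q" for i
        using D[of u i] u q(1) by (auto simp: in_keys_iff)
      show "w = 0" if "monom_scale q w + u \<in> keys c" for w
      proof (rule poly_mapping_eqI)
        fix i
        have "q * lookup w i + lookup u i \<le> D"
          using D[OF that, of i] by (simp add: lookup_add)
        then have "q * lookup w i < q * 1"
          using q(1) by linarith
        then show "lookup w i = lookup 0 i"
          unfolding mult_less_cancel1 by simp
      qed
    qed (use u in auto)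
  qed
qed

section \<open>Contraction to a subset of the variables\<close>

definition monom_restrict :: "'n set \<Rightarrow> 'n::finite monom \<Rightarrow> 'n monom" where
  "monom_restrict A m = monom_of (\<lambda>i. if i \<in> A then lookup m i else 0)"

lemma lookup_monom_restrict: "lookup (monom_restrict A m) i = (if i \<in> A then lookup m i else 0)"
  by (simp add: monom_restrict_def)

lemma keys_monom_restrict: "keys (monom_restrict A m) \<subseteq> A"
  by (auto simp: in_keys_iff lookup_monom_restrict split: if_splits)

lemma monom_restrict_split: "m = monom_restrict A m + monom_restrict (- A) m"
  by (rule poly_mapping_eqI) (simp add: lookup_add lookup_monom_restrict)

lemma keys_add_monom: "keys (m + m' :: 'n monom) = keys m \<union> keys m'"
  by (auto simp: in_keys_iff lookup_add)

lemma monom_split_unique: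
  fixes m m' w w' :: "'n::finite monom"
  assumes "m + w = m' + w'" "keys m \<subseteq> A" "keys m' \<subseteq> A" "keys w \<subseteq> - A" "keys w' \<subseteq> - A"
  shows "m = m'" "w = w'"
proof -
  have *: "lookup m i + lookup w i = lookup m' i + lookup w' i" for i
    using arg_cong[OF assms(1), of "\<lambda>m. lookup m i"] by (simp add: lookup_add)
  have **: "i \<in> A \<Longrightarrow> lookup w i = 0 \<and> lookup w' i = 0" "i \<notin> A \<Longrightarrow> lookup m i = 0 \<and> lookup m' i = 0" for i
    using assms(2-5) by (auto simp: in_keys_iff subset_iff)
  show "m = m'"
  proof (rule poly_mapping_eqI)
    show "lookup m i = lookup m' i" for i
      using *[of i] **[of i] by (cases "i \<in> A") auto
  qed
  then show "w = w'"
    using assms(1) by simp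
qed

text \<open>A subset of the full polynomial type in place of a type with fewer variables, because
  the variables are added one at a time.\<close>

definition polys_in :: "'n set \<Rightarrow> ('n, 'a::zero) mpoly set" where
  "polys_in A = {f. \<forall>m\<in>keys f. keys m \<subseteq> A}"

lemma polys_in_zero: "0 \<in> polys_in A"
  by (simp add: polys_in_def)

lemma polys_in_mono: "A \<subseteq> B \<Longrightarrow> polys_in A \<subseteq> polys_in B"
  by (auto simp: polys_in_def)

lemma polys_in_single: "keys m \<subseteq> A \<Longrightarrow> single m c \<in> polys_in A"
  by (simp add: polys_in_def)

lemma polys_in_diff:
  fixes f g :: "('n, 'a::ab_group_add) mpoly"
  shows "f \<in> polys_in A \<Longrightarrow> g \<in> polys_in A \<Longrightarrow> f - g \<in> polys_in A"
  unfolding polys_in_def by (smt (verit) diff_0 in_keys_iff lookup_minus mem_Collect_eq neg_equal_0_iff_equal)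

lemma polys_in_mult:
  fixes f g :: "('n, 'a::semiring_0) mpoly"
  assumes "f \<in> polys_in A" "g \<in> polys_in A"
  shows "f * g \<in> polys_in A"
  using keys_mult[of f g] assms by (fastforce simp: polys_in_def keys_add_monom)

text \<open>The coefficient of \<open>w\<close> when the variables in \<open>A\<close> are regarded as constants.\<close>

definition part_coeff :: "'n set \<Rightarrow> ('n::finite, 'a::zero) mpoly \<Rightarrow> 'n monom \<Rightarrow> ('n, 'a) mpoly" where
  "part_coeff A f w =
     Abs_poly_mapping (\<lambda>m. if keys m \<subseteq> A \<and> keys w \<subseteq> - A then lookup f (m + w) else 0)"

lemma lookup_part_coeff:
  "lookup (part_coeff A f w) m = (if keys m \<subseteq> A \<and> keys w \<subseteq> - A then lookup f (m + w) else 0)"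
proof -
  have "finite ((\<lambda>m. m + w) -` keys f)"
    by (intro finite_vimageI) (auto simp: inj_def)
  then have "finite {m. (if keys m \<subseteq> A \<and> keys w \<subseteq> - A then lookup f (m + w) else 0) \<noteq> 0}"
    by (rule rev_finite_subset) (auto simp: in_keys_iff split: if_splits)
  then show ?thesis
    by (simp add: part_coeff_def)
qed

lemma part_coeff_zero: "part_coeff A 0 w = 0"
  by (rule poly_mapping_eqI) (simp add: lookup_part_coeff)

lemma part_coeff_add:
  "part_coeff A (f + g :: ('n::finite, 'a::monoid_add) mpoly) w = part_coeff A f w + part_coeff A g w"
  by (rule poly_mapping_eqI) (simp add: lookup_part_coeff lookup_add)

lemma part_coeff_diff:
  "part_coeff A (f - g :: ('n::finite, 'a::ab_group_add) mpoly) w = part_coeff A f w - part_coeff A g w"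
  by (rule poly_mapping_eqI) (simp add: lookup_part_coeff lookup_minus)

lemma part_coeff_sum:
  "part_coeff A (sum f I :: ('n::finite, 'a::comm_monoid_add) mpoly) w = (\<Sum>i\<in>I. part_coeff A (f i) w)"
  by (induction I rule: infinite_finite_induct) (auto simp: part_coeff_zero part_coeff_add)

lemma part_coeff_in_polys_in:
  assumes "f \<in> polys_in C"
  shows "part_coeff A f w \<in> polys_in (A \<inter> C)"
  unfolding polys_in_def
proof safe
  fix m i assume m: "m \<in> keys (part_coeff A f w)" and i: "i \<in> keys m"
  then have "keys m \<subseteq> A" "m + w \<in> keys f"
    by (auto simp: in_keys_iff lookup_part_coeff split: if_splits)
  moreover have "keys (m + w) \<subseteq> C"
    using assms \<open>m + w \<in> keys f\<close> by (auto simp: polys_in_def)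
  ultimately show "i \<in> A" "i \<in> C"
    using i by (auto simp: keys_add_monom)
qed

lemma part_coeff_polys_in: "part_coeff A f w \<in> polys_in A"
  using part_coeff_in_polys_in[of f UNIV A w] by (simp add: polys_in_def)

lemma part_coeff_mult_monom:
  fixes h :: "('n::finite, 'a::comm_semiring_1) mpoly"
  assumes h: "h \<in> polys_in A" and w: "keys w \<subseteq> - A"
  shows "part_coeff A (h * single w 1) x = (if x = w then h else 0)"
proof (rule poly_mapping_eqI)
  fix m
  show "lookup (part_coeff A (h * single w 1) x) m = lookup (if x = w then h else 0) m"
  proof (cases "keys m \<subseteq> A \<and> keys x \<subseteq> - A")
    case True
    show ?thesis
    proof (cases "\<exists>j. m + x = w + j")
      case ex: True
      then obtain j where j: "m + x = w + j" ..
      have "lookup (part_coeff A (h * single w 1) x) m = lookup (single w 1 * h) (w + j)"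
        using True by (simp add: lookup_part_coeff mult.commute flip: j)
      also have "\<dots> = lookup h j"
        by (simp add: lookup_single_mult_add)
      also have "\<dots> = lookup (if x = w then h else 0) m"
      proof (cases "x = w")
        case True
        then show ?thesis
          using j by (simp add: add.commute)
      next
        case False
        have "j \<notin> keys h"
        proof
          assume "j \<in> keys h"
          then have "keys j \<subseteq> A"
            using h by (auto simp: polys_in_def)
          then have "x = w"
            using monom_split_unique(2)[of m x j w A] j True w by (simp add: add.commute)
          with False show False ..
        qed
        then show ?thesis
          using False by (simp add: in_keys_iff)
      qed
      finally show ?thesis .
    next
      case False
      have "lookup (part_coeff A (h * single w 1) x) m = lookup (single w 1 * h) (m + x)"
        using True by (simp add: lookup_part_coeff mult.commute)
      also have "\<dots> = 0"
        using False by (intro lookup_single_mult_eq_0) blast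
      moreover have "x \<noteq> w"
        using False by (metis add.commute)
      ultimately show ?thesis
        by simp
    qed
  next
    case False
    have "lookup h m = 0" if "x = w"
      using False h w that by (auto simp: polys_in_def in_keys_iff)
    then show ?thesis
      using False by (cases "x = w") (auto simp: lookup_part_coeff)
  qed
qed

lemma part_coeff_monom_mult:
  fixes f :: "('n::finite, 'a::comm_semiring_1) mpoly"
  assumes "keys u \<subseteq> - A"
  shows "part_coeff A (single u 1 * f) (u + w) = part_coeff A f w"
proof (rule poly_mapping_eqI)
  fix m
  have "m + (u + w) = u + (m + w)"
    by (simp add: ac_simps)
  then show "lookup (part_coeff A (single u 1 * f) (u + w)) m = lookup (part_coeff A f w) m"
    using assms by (simp add: lookup_part_coeff lookup_single_mult_add keys_add_monom)
qed

lemma part_coeff_expand: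
  fixes f :: "('n::finite, 'a::comm_semiring_1) mpoly"
  shows "f = (\<Sum>w\<in>monom_restrict (- A) ` keys f. part_coeff A f w * single w 1)"
    (is "_ = sum ?t ?W")
proof (rule poly_mapping_eqI)
  fix m
  define r where "r = monom_restrict (- A) m"
  have m: "m = r + monom_restrict A m"
    using monom_restrict_split[of m A] by (simp add: r_def add.commute)
  have "lookup (?t w) m = (if w = r then lookup f m else 0)" if "w \<in> ?W" for w
  proof -
    have w: "keys w \<subseteq> - A"
      using that keys_monom_restrict by blast
    show ?thesis
    proof (cases "\<exists>j. m = w + j")
      case True
      then obtain j where j: "m = w + j" ..
      have "lookup (?t w) m = lookup (part_coeff A f w) j"
        unfolding j by (subst mult.commute) (simp add: lookup_single_mult_add)
      also have "\<dots> = (if w = r then lookup f m else 0)"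
      proof (cases "keys j \<subseteq> A")
        case True
        then have "w = r"
          using monom_split_unique(2)[of j w "monom_restrict A m" r A] w m j
            keys_monom_restrict[of A m] keys_monom_restrict[of "- A" m]
          by (simp add: r_def add.commute)
        then show ?thesis
          using True w by (simp add: lookup_part_coeff j add.commute)
      next
        case False
        have "w \<noteq> r"
        proof
          assume "w = r"
          then have "j = monom_restrict A m"
            using m j by (metis add_left_cancel)
          then show False
            using False keys_monom_restrict by blast
        qed
        then show ?thesis
          using False by (simp add: lookup_part_coeff)
      qed
      finally show ?thesis .
    next
      case False
      then have "w \<noteq> r"
        using m by blast
      moreover have "lookup (?t w) m = 0"
        using False by (subst mult.commute) (auto intro: lookup_single_mult_eq_0)
      ultimately show ?thesis
        by simp
    qed
  qed
  then have "lookup (sum ?t ?W) m = (\<Sum>w\<in>?W. if w = r then lookup f m else 0)"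
    unfolding lookup_sum by (intro sum.cong) auto
  also have "\<dots> = lookup f m"
    by (auto simp: r_def in_keys_iff)
  finally show "lookup f m = lookup (sum ?t ?W) m"
    by simp
qed

lemma part_coeff_mult:
  fixes f g :: "('n::finite, 'a::comm_semiring_1) mpoly"
  shows "part_coeff A (f * g) x =
    (\<Sum>(u, v)\<in>(monom_restrict (- A) ` keys f) \<times> (monom_restrict (- A) ` keys g).
       if x = u + v then part_coeff A f u * part_coeff A g v else 0)"
proof -
  let ?U = "\<lambda>f. monom_restrict (- A) ` keys f"
  have single_add: "single (u + v) (1 :: 'a) = single u 1 * single v 1" for u v :: "'n monom"
    by (simp add: mult_single)
  have "f * g = (\<Sum>u\<in>?U f. part_coeff A f u * single u 1) * (\<Sum>v\<in>?U g. part_coeff A g v * single v 1)"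
    using part_coeff_expand[of f A] part_coeff_expand[of g A] by simp
  also have "\<dots> = (\<Sum>(u, v)\<in>?U f \<times> ?U g. (part_coeff A f u * part_coeff A g v) * single (u + v) 1)"
    unfolding sum_product sum.cartesian_product
    by (intro sum.cong) (auto simp: single_add ac_simps)
  finally have "part_coeff A (f * g) x =
      (\<Sum>(u, v)\<in>?U f \<times> ?U g. part_coeff A ((part_coeff A f u * part_coeff A g v) * single (u + v) 1) x)"
    by (simp add: part_coeff_sum case_prod_unfold)
  also have "\<dots> = (\<Sum>(u, v)\<in>?U f \<times> ?U g. if x = u + v then part_coeff A f u * part_coeff A g v else 0)"
  proof (intro sum.cong refl, clarify)
    fix a b
    have "keys (monom_restrict (- A) a + monom_restrict (- A) b) \<subseteq> - A"
      using keys_monom_restrict[of "- A"] by (simp add: keys_add_monom)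
    then show "part_coeff A (part_coeff A f (monom_restrict (- A) a) * part_coeff A g (monom_restrict (- A) b) *
        single (monom_restrict (- A) a + monom_restrict (- A) b) 1) x =
      (if x = monom_restrict (- A) a + monom_restrict (- A) b
       then part_coeff A f (monom_restrict (- A) a) * part_coeff A g (monom_restrict (- A) b) else 0)"
      by (intro part_coeff_mult_monom polys_in_mult part_coeff_polys_in)
  qed
  finally show ?thesis .
qed

lemma part_coeff_const_mult:
  fixes f :: "('n::finite, 'a::comm_semiring_1) mpoly"
  assumes "a \<in> polys_in A"
  shows "part_coeff A (a * f) w = a * part_coeff A f w"
proof -
  let ?W = "monom_restrict (- A) ` keys f"
  have "a * f = (\<Sum>w\<in>?W. (a * part_coeff A f w) * single w 1)"
    by (subst part_coeff_expand[of f A]) (simp add: sum_distrib_left mult.assoc)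
  then have "part_coeff A (a * f) w = (\<Sum>u\<in>?W. part_coeff A ((a * part_coeff A f u) * single u 1) w)"
    by (simp add: part_coeff_sum)
  also have "\<dots> = (\<Sum>u\<in>?W. a * part_coeff A (part_coeff A f u * single u 1) w)"
  proof (intro sum.cong refl, clarify)
    fix b
    show "part_coeff A (a * part_coeff A f (monom_restrict (- A) b) * single (monom_restrict (- A) b) 1) w =
      a * part_coeff A (part_coeff A f (monom_restrict (- A) b) * single (monom_restrict (- A) b) 1) w"
      using assms by (simp add: part_coeff_mult_monom polys_in_mult part_coeff_polys_in keys_monom_restrict)
  qed
  also have "\<dots> = a * part_coeff A (\<Sum>u\<in>?W. part_coeff A f u * single u 1) w"
    by (simp add: part_coeff_sum sum_distrib_left)
  finally show ?thesis
    using part_coeff_expand[of f A] by simp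
qed

text \<open>The extension to the whole ring of the contraction of \<open>P\<close> to the polynomials in \<open>A\<close>.\<close>

definition contract_extend :: "'n set \<Rightarrow> ('n::finite, 'a::zero) mpoly set \<Rightarrow> ('n, 'a) mpoly set" where
  "contract_extend A P = {f. \<forall>w. part_coeff A f w \<in> P}"

lemma contract_extend_polys_in_iff:
  fixes f :: "('n::finite, 'a::comm_semiring_1) mpoly"
  assumes "f \<in> polys_in A" "0 \<in> P"
  shows "f \<in> contract_extend A P \<longleftrightarrow> f \<in> P"
proof -
  have "part_coeff A f w = (if w = 0 then f else 0)" for w
    using part_coeff_mult_monom[OF assms(1), of 0 w] by simp
  then show ?thesis
    using assms(2) by (auto simp: contract_extend_def)
qed

lemma monom_restrict_insert:
  fixes m :: "'n::finite monom"
  assumes "keys m \<subseteq> insert z A" "z \<notin> A"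
  shows "m = monom_restrict A m + single z (lookup m z)"
proof (rule poly_mapping_eqI)
  fix i
  show "lookup m i = lookup (monom_restrict A m + single z (lookup m z)) i"
    using assms by (cases "i = z")
      (auto simp: lookup_add lookup_monom_restrict lookup_single in_keys_iff subset_iff)
qed

text \<open>Turns a vanishing top coefficient into a drop of the z-degree, both when a leading term
  is removed and in pseudo-division.\<close>

lemma part_coeff_top_zero:
  fixes f :: "('n::finite, 'a::zero) mpoly"
  assumes "f \<in> polys_in (insert z A)" "z \<notin> A" "part_coeff A f (single z n) = 0"
    and "m \<in> keys f" "lookup m z \<le> n"
  shows "lookup m z < n"
proof (rule ccontr)
  assume "\<not> lookup m z < n"
  then have n: "lookup m z = n"
    using assms(5) by simp
  have "m = monom_restrict A m + single z n"
    using monom_restrict_insert[of m z A] assms by (auto simp: n polys_in_def)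
  then have "lookup (part_coeff A f (single z n)) (monom_restrict A m) = lookup f m"
    using keys_monom_restrict[of A m] assms(2) by (simp add: lookup_part_coeff)
  then show False
    using assms by (simp add: in_keys_iff)
qed

section \<open>Contracted primes and local generators\<close>

context
  fixes P :: "('n::{finite,linorder}, 'a::field) mpoly set"
  assumes P: "is_prime_ideal P"
begin

private lemma P_ideal: "is_ideal P"
  using P by (rule is_prime_ideal_imp_is_ideal)

lemma contract_extend_UNIV: "contract_extend UNIV P = P"
  using contract_extend_polys_in_iff[of _ UNIV P] is_ideal_0[OF P_ideal] by (auto simp: polys_in_def)

text \<open>The argument of Gauss's lemma: take in each factor the largest exponent with coefficient
  outside \<open>P\<close>. Modulo \<open>P\<close>, the coefficient of the product at the sum of
  the two is the product of the two coefficients.\<close>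

lemma contract_extend_prime: "is_prime_ideal (contract_extend A P)"
  unfolding is_prime_ideal_iff
proof (intro conjI allI impI)
  show "is_ideal (contract_extend A P)"
    unfolding is_ideal_iff contract_extend_def
    using P_ideal
    by (auto simp: part_coeff_zero part_coeff_add part_coeff_mult case_prod_unfold
        intro!: is_ideal_0 is_ideal_add is_ideal_sum is_ideal_mult)
  show "1 \<notin> contract_extend A P"
    using contract_extend_polys_in_iff[of 1 A P] P is_ideal_0[OF P_ideal]
    by (auto simp: polys_in_def is_prime_ideal_iff)
  fix f g assume fg: "f * g \<in> contract_extend A P"
  show "f \<in> contract_extend A P \<or> g \<in> contract_extend A P"
  proof (rule ccontr)
    assume *: "\<not> (f \<in> contract_extend A P \<or> g \<in> contract_extend A P)"
    define W where "W f = monom_restrict (- A) ` keys f" for f :: "('n, 'a) mpoly"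
    define B where "B f = {w \<in> W f. part_coeff A f w \<notin> P}" for f
    have in_B: "w \<in> B f" if "part_coeff A f w \<notin> P" for f w
    proof -
      have "part_coeff A f w \<noteq> 0"
        using that is_ideal_0[OF P_ideal] by metis
      then obtain m where m: "lookup (part_coeff A f w) m \<noteq> 0"
        by (metis lookup_zero poly_mapping_eqI)
      then have "keys m \<subseteq> A" "keys w \<subseteq> - A" "m + w \<in> keys f"
        by (auto simp: lookup_part_coeff in_keys_iff split: if_splits)
      moreover have "w = monom_restrict (- A) (m + w)"
        using calculation monom_split_unique(2)[OF monom_restrict_split[of "m + w" A], of A] keys_monom_restrict
        by (metis Compl_iff)
      ultimately show ?thesis
        using that by (auto simp: B_def W_def)
    qed
    have fin: "finite (B f)" "finite (W f)" for f
      by (auto simp: B_def W_def)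
    have ne: "B f \<noteq> {}" "B g \<noteq> {}"
      using * in_B by (auto simp: contract_extend_def)
    \<comment> \<open>\<open>Max\<close> refers to the order on exponents induced by the order of
      the variables; what matters is that it is total and compatible with addition.\<close>
    define u where "u = Max (B f)"
    define v where "v = Max (B g)"
    have u: "u \<in> B f" and v: "v \<in> B g"
      unfolding u_def v_def using fin ne by (auto intro: Max_in)
    have le: "w \<le> u" if "part_coeff A f w \<notin> P" for w
      unfolding u_def using in_B[OF that] fin by (intro Max_ge) auto
    have le': "w \<le> v" if "part_coeff A g w \<notin> P" for w
      unfolding v_def using in_B[OF that] fin by (intro Max_ge) auto
    let ?t = "\<lambda>z. if u + v = fst z + snd z then part_coeff A f (fst z) * part_coeff A g (snd z) else 0"
    have "part_coeff A (f * g) (u + v) = sum ?t (W f \<times> W g)"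
      by (simp add: part_coeff_mult W_def case_prod_unfold)
    also have "\<dots> = ?t (u, v) + sum ?t (W f \<times> W g - {(u, v)})"
      using fin u v by (intro sum.remove) (auto simp: B_def)
    finally have "?t (u, v) = part_coeff A (f * g) (u + v) - sum ?t (W f \<times> W g - {(u, v)})"
      by simp
    moreover have "sum ?t (W f \<times> W g - {(u, v)}) \<in> P"
    proof (rule is_ideal_sum[OF P_ideal])
      fix z assume z: "z \<in> W f \<times> W g - {(u, v)}"
      show "?t z \<in> P"
      proof (cases "u + v = fst z + snd z \<and> part_coeff A f (fst z) \<notin> P \<and> part_coeff A g (snd z) \<notin> P")
        case True
        then have "fst z \<le> u" "snd z \<le> v" "u + v = fst z + snd z"
          using le le' by auto
        moreover have "fst z = u"
        proof (rule ccontr)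
          assume "fst z \<noteq> u"
          then have "fst z + snd z < u + v"
            using calculation by (intro add_less_le_mono) auto
          then show False
            using calculation(3) by simp
        qed
        ultimately have "fst z = u \<and> snd z = v"
          by simp
        then show ?thesis
          using z by (cases z) auto
      next
        case False
        then show ?thesis
          using P_ideal by (auto intro: is_ideal_0 is_ideal_mult is_ideal_mult_right)
      qed
    qed
    ultimately have "?t (u, v) \<in> P"
      using fg by (auto simp: contract_extend_def intro!: is_ideal_diff[OF P_ideal])
    then show False
      using u v P by (auto simp: B_def is_prime_ideal_iff)
  qed
qed

lemma contract_extend_mono:
  assumes "A \<subseteq> B"
  shows "contract_extend A P \<subseteq> contract_extend B P"
proof
  fix f assume f: "f \<in> contract_extend A P"
  have idl: "is_ideal (contract_extend B P)"
    using contract_extend_prime is_prime_ideal_imp_is_ideal by blast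
  have "part_coeff A f w \<in> contract_extend B P" for w
    using f contract_extend_polys_in_iff[of "part_coeff A f w" B P] is_ideal_0[OF P_ideal]
      part_coeff_polys_in[of A f w] polys_in_mono[OF assms]
    by (auto simp: contract_extend_def)
  then show "f \<in> contract_extend B P"
    by (subst part_coeff_expand[of f A]) (intro is_ideal_sum is_ideal_mult_right idl)
qed

text \<open>Pseudo-division by a polynomial of minimal \<open>z\<close>-degree whose leading coefficient is a
  unit at \<open>P\<close>.\<close>

lemma local_generator_step:
  assumes z: "z \<notin> A"
    and ne: "\<exists>f \<in> P \<inter> polys_in (insert z A). f \<notin> contract_extend A P"
    and Y: "Y \<subseteq> P" "P \<inter> polys_in A \<subseteq> saturation P (ideal_gen Y)"
  obtains g where "g \<in> P" "P \<inter> polys_in (insert z A) \<subseteq> saturation P (ideal_gen (insert g Y))"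
proof -
  have E_ideal: "is_ideal (contract_extend A P)"
    using contract_extend_prime is_prime_ideal_imp_is_ideal by blast
  \<comment> \<open>Members of the extension from \<open>A\<close> are already covered by
    \<open>Y\<close>, so the divisor is sought among the others, with the z-degree bounded by
    \<open>n\<close>.\<close>
  define C where "C n f \<longleftrightarrow> f \<in> P \<inter> polys_in (insert z A) \<and> f \<notin> contract_extend A P \<and>
    (\<forall>m\<in>keys f. lookup m z \<le> n)" for n f
  have "\<exists>n f. C n f"
  proof -
    obtain f where f: "f \<in> P \<inter> polys_in (insert z A)" "f \<notin> contract_extend A P"
      using ne by blast
    have "\<forall>m\<in>keys f. lookup m z \<le> Max ((\<lambda>m. lookup m z) ` keys f)"
      by simp
    with f show ?thesis
      unfolding C_def by blast
  qed
  then obtain n where n: "\<exists>g. C n g" and least: "\<And>k f. C k f \<Longrightarrow> n \<le> k"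
    using exists_least_iff[of "\<lambda>n. \<exists>g. C n g"] by (metis not_le)
  then obtain g where g: "C n g"
    by blast
  have g_P: "g \<in> P" and g_in: "g \<in> polys_in (insert z A)" and g_E: "g \<notin> contract_extend A P"
    and g_deg: "\<And>m. m \<in> keys g \<Longrightarrow> lookup m z \<le> n"
    using g by (auto simp: C_def)
  define a where "a = part_coeff A g (single z n)"
  have a_in: "a \<in> polys_in A"
    by (simp add: a_def part_coeff_polys_in)
  have z_keys: "keys (single z k) \<subseteq> - A" for k :: nat
    using z by simp
  have poly_A_insert: "h \<in> polys_in (insert z A)" if "h \<in> polys_in A" for h :: "('n, 'a) mpoly"
    using that polys_in_mono[of A "insert z A"] by blast
  have monom_z: "single (single z k) 1 \<in> polys_in (insert z A)" for k
    by (intro polys_in_single) simp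
  have deg_A: "lookup m z = 0" if "h \<in> polys_in A" "m \<in> keys h" for h :: "('n, 'a) mpoly" and m
  proof -
    have "z \<notin> keys m"
      using that z by (auto simp: polys_in_def)
    then show ?thesis
      by (simp add: in_keys_iff)
  qed
  have deg_monom_mult: "lookup m z \<le> k + d"
    if "h \<in> polys_in A" "\<And>m. m \<in> keys f \<Longrightarrow> lookup m z \<le> d" "m \<in> keys (h * single (single z k) 1 * f)"
    for h f :: "('n, 'a) mpoly" and k d :: nat and m
  proof -
    obtain m1 m2 where m: "m = m1 + m2" "m1 \<in> keys (h * single (single z k) 1)" "m2 \<in> keys f"
      using keys_mult[of "h * single (single z k) 1" f] \<open>m \<in> _\<close> by blast
    obtain m3 where "m1 = m3 + single z k" "m3 \<in> keys h"
      using keys_mult[of h "single (single z k) 1"] m(2) by auto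
    then show ?thesis
      using deg_A[OF that(1)] that(2)[OF m(3)] by (simp add: m(1) lookup_add)
  qed
  \<comment> \<open>Otherwise removing the top term would leave a member of \<open>P\<close>, still
    outside the extension, of smaller z-degree. Hence \<open>a\<close> can be cancelled in the
    saturation.\<close>
  have a_P: "a \<notin> P"
  proof
    assume a: "a \<in> P"
    define h where "h = g - a * single (single z n) 1"
    have "h \<in> P"
      unfolding h_def using a g_P by (intro is_ideal_diff is_ideal_mult_right P_ideal)
    moreover have h_in: "h \<in> polys_in (insert z A)"
      unfolding h_def using a_in by (intro polys_in_diff g_in polys_in_mult poly_A_insert monom_z)
    moreover have h_E: "h \<notin> contract_extend A P"
    proof
      assume "h \<in> contract_extend A P"
      moreover have "a * single (single z n) 1 \<in> contract_extend A P"
        using a contract_extend_polys_in_iff[OF a_in is_ideal_0[OF P_ideal]]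
        by (intro is_ideal_mult_right E_ideal) auto
      ultimately have "h + a * single (single z n) 1 \<in> contract_extend A P"
        by (intro is_ideal_add E_ideal)
      then show False
        using g_E by (simp add: h_def)
    qed
    moreover have h_deg: "lookup m z < n" if "m \<in> keys h" for m
    proof (rule part_coeff_top_zero[OF h_in z _ that])
      show "part_coeff A h (single z n) = 0"
        unfolding h_def part_coeff_diff part_coeff_mult_monom[OF a_in z_keys] by (simp add: a_def)
      have "m \<in> keys g \<or> m \<in> keys (a * single (single z n) 1 * 1)"
        using that by (auto simp: h_def in_keys_iff lookup_minus)
      then show "lookup m z \<le> n"
        using g_deg deg_monom_mult[OF a_in, of 1 0 m n] by fastforce
    qed
    moreover have "n > 0"
    proof (rule ccontr)
      assume "\<not> n > 0"
      then have "h = 0"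
        using h_deg by (intro poly_mapping_eqI) (auto simp: in_keys_iff)
      then show False
        using h_E is_ideal_0[OF E_ideal] by simp
    qed
    ultimately have "C (n - 1) h"
      by (fastforce simp: C_def)
    then show False
      using least \<open>n > 0\<close> by fastforce
  qed
  let ?S = "saturation P (ideal_gen (insert g Y))"
  have S: "is_ideal ?S"
    by (intro is_ideal_saturation P is_ideal_gen)
  have YS: "saturation P (ideal_gen Y) \<subseteq> ?S"
    using ideal_gen_mono[of Y "insert g Y"] by (auto simp: saturation_def)
  have gS: "g \<in> ?S"
    using subset_saturation[OF P] ideal_gen_superset[of "insert g Y"] by blast
  have "f \<in> ?S" if "f \<in> P" "f \<in> polys_in (insert z A)" "\<forall>m\<in>keys f. lookup m z < N" for f N
    using that
  proof (induction N arbitrary: f)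
    case 0
    then have "f = 0"
      by (intro poly_mapping_eqI) (auto simp: in_keys_iff)
    then show ?case
      using is_ideal_0[OF S] by simp
  next
    case (Suc N)
    show ?case
    proof (cases "f \<in> contract_extend A P")
      case True
      \<comment> \<open>All coefficients of \<open>f\<close> over \<open>A\<close> lie in
        \<open>P\<close>, so \<open>Y\<close> suffices locally and no division takes place.\<close>
      then have "part_coeff A f w \<in> ?S" for w
        using Y(2) YS part_coeff_polys_in[of A f w] by (auto simp: contract_extend_def)
      then show ?thesis
        by (subst part_coeff_expand[of f A]) (intro is_ideal_sum is_ideal_mult_right S)
    next
      case False
      then have "C N f"
        using Suc.prems by (auto simp: C_def less_Suc_eq_le)
      then have nN: "n \<le> N"
        by (rule least)
      define b where "b = part_coeff A f (single z N)"
      have b_in: "b \<in> polys_in A"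
        by (simp add: b_def part_coeff_polys_in)
      define k where "k = b * single (single z (N - n)) 1 * g"
      define h where "h = a * f - k"
      have kS: "k \<in> ?S" and kP: "k \<in> P"
        unfolding k_def using S P_ideal gS g_P by (auto intro: is_ideal_mult)
      have h_in: "h \<in> polys_in (insert z A)"
        unfolding h_def k_def using poly_A_insert[OF a_in] poly_A_insert[OF b_in] Suc.prems(2)
        by (intro polys_in_diff polys_in_mult monom_z g_in)
      have "h \<in> ?S"
      proof (rule Suc.IH)
        show "h \<in> P"
          unfolding h_def using Suc.prems(1) kP by (intro is_ideal_diff is_ideal_mult P_ideal)
        show "\<forall>m\<in>keys h. lookup m z < N"
        proof
          fix m assume m: "m \<in> keys h"
          show "lookup m z < N"
          proof (rule part_coeff_top_zero[OF h_in z _ m])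
            have "part_coeff A (single (single z (N - n)) 1 * g) (single z (N - n) + single z n) = a"
              unfolding a_def by (rule part_coeff_monom_mult[OF z_keys])
            then have "part_coeff A (single (single z (N - n)) 1 * g) (single z N) = a"
              using nN by (simp flip: single_add)
            then have "part_coeff A k (single z N) = b * a"
              unfolding k_def mult.assoc part_coeff_const_mult[OF b_in] by simp
            then show "part_coeff A h (single z N) = 0"
              unfolding h_def part_coeff_diff part_coeff_const_mult[OF a_in]
              by (simp add: b_def mult.commute)
            have "m \<in> keys (a * single (single z 0) 1 * f) \<or> m \<in> keys k"
              using m by (auto simp: h_def in_keys_iff lookup_minus)
            then show "lookup m z \<le> N"
            proof
              assume "m \<in> keys k"
              then show ?thesis
                using deg_monom_mult[OF b_in, of g n m "N - n"] g_deg nN by (simp add: k_def)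
            next
              assume "m \<in> keys (a * single (single z 0) 1 * f)"
              then show ?thesis
                using deg_monom_mult[OF a_in, of f N m 0] Suc.prems(3) by (simp add: less_Suc_eq_le)
            qed
          qed
        qed
      qed (rule h_in)
      then have "h + k \<in> ?S"
        by (intro is_ideal_add S kS)
      then have "a * f \<in> ?S"
        by (simp add: h_def)
      then show ?thesis
        by (rule mem_saturation_cancel[OF P a_P])
    qed
  qed
  moreover have "\<exists>N. \<forall>m\<in>keys f. lookup m z < N" for f :: "('n, 'a) mpoly"
    by (rule exI[of _ "Suc (Max ((\<lambda>m. lookup m z) ` keys f))"]) (simp add: less_Suc_eq_le)
  ultimately have "P \<inter> polys_in (insert z A) \<subseteq> ?S"
    by blast
  then show thesis
    using that g_P by blast
qed

text \<open>\<open>A\<close> is a maximal set of variables that are algebraically independent modulo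
  \<open>P\<close>. By maximality each further variable enlarges the extended contraction strictly,
  and it costs at most one generator. The same number is thus the length of a chain and a bound for
  the generators, so that the definition of height applies directly.\<close>

lemma prime_chain_and_local_generators:
  obtains n Q Y where "\<And>i. i \<le> n \<Longrightarrow> is_prime_ideal (Q i)" "\<And>i. i < n \<Longrightarrow> Q i \<subset> Q (Suc i)" "Q n = P"
    "finite Y" "card Y \<le> n" "Y \<subseteq> P" "P \<subseteq> saturation P (ideal_gen Y)"
proof -
  have empty: "P \<inter> polys_in {} = {0}"
  proof -
    have "f = 0" if "f \<in> P" "f \<in> polys_in {}" for f
    proof (rule ccontr)
      assume f: "f \<noteq> 0"
      have "lookup f m = 0" if "m \<noteq> 0" for m
        using \<open>f \<in> polys_in {}\<close> that
        by (metis (no_types, lifting) in_keys_iff keys_zero lookup_zero mem_Collect_eq poly_mapping_eqI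
            polys_in_def subset_empty)
      then have "f = single 0 (lookup f 0)"
        by (intro poly_mapping_eqI) (auto simp: lookup_single when_def)
      then show False
        using f constant_ideal_UNIV[OF P_ideal, of "lookup f 0"] \<open>f \<in> P\<close> P
        by (metis UNIV_I is_prime_ideal_iff single_zero)
    qed
    then show ?thesis
      using is_ideal_0[OF P_ideal] polys_in_zero by blast
  qed
  define \<S> where "\<S> = {A. P \<inter> polys_in A = {0}}"
  have "finite \<S>" "\<S> \<noteq> {}"
    using empty by (auto simp: \<S>_def)
  then obtain A where "A \<in> \<S>" and maximal: "\<And>B. B \<in> \<S> \<Longrightarrow> A \<subseteq> B \<Longrightarrow> A = B"
    using finite_has_maximal[of \<S>] by metis
  then have A: "P \<inter> polys_in A = {0}"
    by (simp add: \<S>_def)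
  define R where "R Z \<longleftrightarrow> (\<exists>Q Y. (\<forall>i\<le>card Z. is_prime_ideal (Q i)) \<and> (\<forall>i<card Z. Q i \<subset> Q (Suc i)) \<and>
      Q (card Z) = contract_extend (A \<union> Z) P \<and> finite Y \<and> card Y \<le> card Z \<and> Y \<subseteq> P \<and>
      P \<inter> polys_in (A \<union> Z) \<subseteq> saturation P (ideal_gen Y))" for Z
  have "R Z" if "Z \<subseteq> - A" for Z
    using finite[of Z] that
  proof (induction Z rule: finite_induct)
    case empty
    have "0 \<in> saturation P (ideal_gen {})"
      by (intro is_ideal_0 is_ideal_saturation P is_ideal_gen)
    then have "P \<inter> polys_in A \<subseteq> saturation P (ideal_gen {})"
      by (simp add: A)
    then show ?case
      unfolding R_def
      by (intro exI[of _ "\<lambda>_. contract_extend A P"] exI[of _ "{}"]) (simp add: contract_extend_prime)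
  next
    case (insert z Z)
    then have "R Z"
      by simp
    then obtain Q Y where Q: "\<And>i. i \<le> card Z \<Longrightarrow> is_prime_ideal (Q i)"
        "\<And>i. i < card Z \<Longrightarrow> Q i \<subset> Q (Suc i)" "Q (card Z) = contract_extend (A \<union> Z) P"
      and Y: "finite Y" "card Y \<le> card Z" "Y \<subseteq> P" "P \<inter> polys_in (A \<union> Z) \<subseteq> saturation P (ideal_gen Y)"
      unfolding R_def by blast
    have z: "z \<notin> A" "z \<notin> A \<union> Z"
      using insert by auto
    have "P \<inter> polys_in (insert z A) \<noteq> {0}"
      using maximal[of "insert z A"] z by (auto simp: \<S>_def)
    then obtain f where f: "f \<in> P" "f \<in> polys_in (insert z A)" "f \<noteq> 0"
      using is_ideal_0[OF P_ideal] polys_in_zero by blast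
    have f_in: "f \<in> polys_in (insert z (A \<union> Z))"
      using f(2) polys_in_mono[of "insert z A" "insert z (A \<union> Z)"] by blast
    have f_E: "f \<notin> contract_extend (A \<union> Z) P"
    proof
      assume f_E: "f \<in> contract_extend (A \<union> Z) P"
      \<comment> \<open>\<open>f\<close> involves only \<open>z\<close> and variables from
        \<open>A\<close>, so its coefficients over \<open>A \<union> Z\<close> are polynomials in
        \<open>A\<close>, where \<open>P\<close> contains nothing but zero.\<close>
      have "part_coeff (A \<union> Z) f w = 0" for w
      proof -
        have "part_coeff (A \<union> Z) f w \<in> polys_in A"
          using part_coeff_in_polys_in[OF f(2), of "A \<union> Z" w] polys_in_mono[of "(A \<union> Z) \<inter> insert z A" A] z
          by blast
        then show ?thesis
          using A f_E by (auto simp: contract_extend_def)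
      qed
      then have "f = 0"
        by (subst part_coeff_expand[of f "A \<union> Z"]) simp
      with f(3) show False ..
    qed
    obtain g where g: "g \<in> P" "P \<inter> polys_in (insert z (A \<union> Z)) \<subseteq> saturation P (ideal_gen (insert g Y))"
      using local_generator_step[OF z(2) _ Y(3,4)] f(1) f_in f_E by blast
    define Q' where "Q' i = (if i \<le> card Z then Q i else contract_extend (insert z (A \<union> Z)) P)" for i
    have "contract_extend (A \<union> Z) P \<subset> contract_extend (insert z (A \<union> Z)) P"
      using contract_extend_mono[of "A \<union> Z" "insert z (A \<union> Z)"] f_E f(1)
        contract_extend_polys_in_iff[OF f_in is_ideal_0[OF P_ideal]] by blast
    then have "Q' i \<subset> Q' (Suc i)" if "i \<le> card Z" for i
      using Q that by (cases "i = card Z") (auto simp: Q'_def)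
    moreover have "is_prime_ideal (Q' i)" for i
      using Q by (simp add: Q'_def contract_extend_prime)
    ultimately show ?case
      unfolding R_def using insert Y g
      by (intro exI[of _ Q'] exI[of _ "insert g Y"])
        (auto simp: Q'_def card_insert_if intro: le_SucI)
  qed
  then have "R (- A)"
    by simp
  then obtain Q Y where "\<And>i. i \<le> card (- A) \<Longrightarrow> is_prime_ideal (Q i)"
      "\<And>i. i < card (- A) \<Longrightarrow> Q i \<subset> Q (Suc i)" "Q (card (- A)) = P"
      "finite Y" "card Y \<le> card (- A)" "Y \<subseteq> P" "P \<subseteq> saturation P (ideal_gen Y)"
    unfolding R_def by (auto simp: contract_extend_UNIV polys_in_def)
  then show thesis
    by (rule that)
qed

end

section \<open>Heights\<close>

text \<open>Each variable is bounded separately, so that the admissible monomials form a box whose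
  size is a power of its side.\<close>

definition exponents_le :: "nat \<Rightarrow> ('n, 'a::zero) mpoly \<Rightarrow> bool" where
  "exponents_le D f \<longleftrightarrow> (\<forall>m\<in>keys f. \<forall>i. lookup m i \<le> D)"

lemma exponents_le_mult:
  fixes f g :: "('n, 'a::semiring_0) mpoly"
  assumes "exponents_le D f" "exponents_le E g"
  shows "exponents_le (D + E) (f * g)"
  unfolding exponents_le_def
proof (intro ballI allI)
  fix m i assume "m \<in> keys (f * g)"
  then obtain a b where "m = a + b" "a \<in> keys f" "b \<in> keys g"
    using keys_mult[of f g] by blast
  then show "lookup m i \<le> D + E"
    using assms by (auto simp: exponents_le_def lookup_add intro: add_mono)
qed

lemma exponents_le_one: "exponents_le D (1 :: ('n, 'a::semiring_1) mpoly)"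
  by (simp add: exponents_le_def)

lemma exponents_le_power:
  fixes f :: "('n, 'a::comm_semiring_1) mpoly"
  shows "exponents_le D f \<Longrightarrow> exponents_le (k * D) (f ^ k)"
  by (induction k) (auto simp: exponents_le_one intro: exponents_le_mult)

lemma exponents_le_prod:
  fixes f :: "'b \<Rightarrow> ('n, 'a::comm_semiring_1) mpoly"
  assumes "\<And>i. i \<in> I \<Longrightarrow> exponents_le D (f i)"
  shows "exponents_le (card I * D) (prod f I)"
  using assms
  by (induction I rule: infinite_finite_induct) (auto simp: exponents_le_one intro: exponents_le_mult)

lemma exponents_le_mono: "exponents_le D f \<Longrightarrow> D \<le> E \<Longrightarrow> exponents_le E f"
  by (meson exponents_le_def le_trans)

text \<open>Reducing modulo \<open>Q (Suc j)\<close> kills all but the terms of minimal degree in \<open>f j\<close>, so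
  elements \<open>f j \<in> Q (Suc j) - Q j\<close> along a chain of primes are algebraically independent.\<close>

lemma prime_chain_independent:
  fixes Q :: "nat \<Rightarrow> ('n::{finite,linorder}, 'a::field) mpoly set"
  assumes Q: "\<And>i. i \<le> n \<Longrightarrow> is_prime_ideal (Q i)"
    and f: "\<And>i. i < n \<Longrightarrow> f i \<in> Q (Suc i) - Q i" and sub: "\<And>i. i < n \<Longrightarrow> Q i \<subseteq> Q (Suc i)"
    and "finite E" "j \<le> n"
    and distinct: "\<And>e e'. e \<in> E \<Longrightarrow> e' \<in> E \<Longrightarrow> (\<forall>i\<in>{j..<n}. e i = e' i) \<Longrightarrow> e = e'"
    and "(\<Sum>e\<in>E. single 0 (c e) * (\<Prod>i\<in>{j..<n}. f i ^ e i)) \<in> Q j"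
  shows "\<forall>e\<in>E. c e = 0"
  using assms(4-)
proof (induction "n - j" arbitrary: j E)
  case 0
  then have j: "j = n"
    by simp
  show ?case
  proof
    fix e assume e: "e \<in> E"
    \<comment> \<open>With \<open>j = n\<close> no coordinates remain to distinguish members of
      \<open>E\<close>, and a proper ideal contains no nonzero constant.\<close>
    then have "E = {e}"
      using 0(4) j by auto
    then have "single 0 (c e) \<in> Q n"
      using 0(5) j by simp
    then show "c e = 0"
      using constant_ideal_UNIV[of "Q n" "c e"] Q[of n] by (auto simp: is_prime_ideal_iff)
  qed
next
  case (Suc d)
  then have j: "j < n" "d = n - Suc j"
    by auto
  define E' where "E' = {e \<in> E. c e \<noteq> 0}"
  define T where "T e = single 0 (c e) * (\<Prod>i\<in>{Suc j..<n}. f i ^ e i)" for e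
  have prod: "(\<Prod>i\<in>{j..<n}. f i ^ e i) = f j ^ e j * (\<Prod>i\<in>{Suc j..<n}. f i ^ e i)" for e
    using j by (simp add: prod.atLeast_Suc_lessThan)
  have Qj: "is_prime_ideal (Q j)" "is_ideal (Q j)" "is_ideal (Q (Suc j))"
    using Q[of j] Q[of "Suc j"] j by (auto simp: is_prime_ideal_iff)
  have "E' = {}"
  proof (rule ccontr)
    assume ne: "E' \<noteq> {}"
    have fin: "finite E'"
      using Suc.prems(1) by (simp add: E'_def)
    \<comment> \<open>The power \<open>f j ^ k\<close> lies outside the prime \<open>Q j\<close>, so
      it can be divided out of the relation before passing to \<open>Q (Suc j)\<close>.\<close>
    define k where "k = Min ((\<lambda>e. e j) ` E')"
    have k: "k \<le> e j" if "e \<in> E'" for e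
      using fin that by (simp add: k_def)
    have "(\<Sum>e\<in>E. single 0 (c e) * (\<Prod>i\<in>{j..<n}. f i ^ e i)) = (\<Sum>e\<in>E'. f j ^ e j * T e)"
      unfolding prod T_def E'_def using Suc.prems(1)
      by (intro sum.mono_neutral_cong_right) (auto simp: ac_simps)
    also have "\<dots> = (\<Sum>e\<in>E'. f j ^ k * (f j ^ (e j - k) * T e))"
      using k by (intro sum.cong) (auto simp flip: mult.assoc power_add)
    also have "\<dots> = f j ^ k * (\<Sum>e\<in>E'. f j ^ (e j - k) * T e)"
      by (simp add: sum_distrib_left)
    finally have "f j ^ k * (\<Sum>e\<in>E'. f j ^ (e j - k) * T e) \<in> Q j"
      using Suc.prems(4) by simp
    moreover have "f j ^ k \<notin> Q j"
      using f[OF j(1)] is_prime_ideal_power_notin[OF Qj(1)] by blast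
    ultimately have "(\<Sum>e\<in>E'. f j ^ (e j - k) * T e) \<in> Q j"
      using Qj(1) by (auto simp: is_prime_ideal_iff)
    then have all: "(\<Sum>e\<in>E'. f j ^ (e j - k) * T e) \<in> Q (Suc j)"
      using sub[OF j(1)] by blast
    have split: "(\<Sum>e\<in>E'. f j ^ (e j - k) * T e) =
        (\<Sum>e\<in>{e\<in>E'. e j = k}. T e) + (\<Sum>e\<in>{e\<in>E'. e j \<noteq> k}. f j ^ (e j - k) * T e)"
    proof -
      have "E' = {e\<in>E'. e j = k} \<union> {e\<in>E'. e j \<noteq> k}"
        by blast
      then have "(\<Sum>e\<in>E'. f j ^ (e j - k) * T e) =
          (\<Sum>e\<in>{e\<in>E'. e j = k} \<union> {e\<in>E'. e j \<noteq> k}. f j ^ (e j - k) * T e)"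
        by simp
      also have "\<dots> = (\<Sum>e\<in>{e\<in>E'. e j = k}. f j ^ (e j - k) * T e) +
          (\<Sum>e\<in>{e\<in>E'. e j \<noteq> k}. f j ^ (e j - k) * T e)"
        using fin by (intro sum.union_disjoint) auto
      finally show ?thesis
        by simp
    qed
    have rest: "(\<Sum>e\<in>{e\<in>E'. e j \<noteq> k}. f j ^ (e j - k) * T e) \<in> Q (Suc j)"
    proof (rule is_ideal_sum[OF Qj(3)])
      fix e assume "e \<in> {e \<in> E'. e j \<noteq> k}"
      then have "k < e j"
        using k[of e] by auto
      then obtain r where "e j - k = Suc r"
        by (metis Suc_diff_Suc)
      moreover have "f j * (f j ^ r * T e) \<in> Q (Suc j)"
        using f[OF j(1)] by (intro is_ideal_mult_right Qj(3)) auto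
      ultimately show "f j ^ (e j - k) * T e \<in> Q (Suc j)"
        by (simp add: mult.assoc)
    qed
    have "(\<Sum>e\<in>{e\<in>E'. e j = k}. T e) \<in> Q (Suc j)"
      using is_ideal_diff[OF Qj(3) all rest] unfolding split by simp
    moreover have "e = e'" if "e \<in> {e\<in>E'. e j = k}" "e' \<in> {e\<in>E'. e j = k}"
      "\<forall>i\<in>{Suc j..<n}. e i = e' i" for e e'
    proof (rule Suc.prems(3))
      show "\<forall>i\<in>{j..<n}. e i = e' i"
      proof
        fix i assume "i \<in> {j..<n}"
        then show "e i = e' i"
          using that by (cases "i = j") auto
      qed
    qed (use that in \<open>auto simp: E'_def\<close>)
    ultimately have "\<forall>e\<in>{e\<in>E'. e j = k}. c e = 0"
      using fin j unfolding T_def by (intro Suc.hyps(1)) auto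
    moreover have "k \<in> (\<lambda>e. e j) ` E'"
      unfolding k_def using fin ne by (intro Min_in) auto
    ultimately show False
      by (auto simp: E'_def)
  qed
  then show ?case
    by (auto simp: E'_def)
qed

text \<open>A longer chain yields one more independent element than there are variables, namely N of
  them. Their products with exponents up to D number (D + 1)^N, yet they lie in the span of a box of
  (N D B + 1)^(N - 1) monomials, which is too small for large D.\<close>

lemma prime_chain_length:
  fixes Q :: "nat \<Rightarrow> ('n::{finite,linorder}, 'a::field) mpoly set"
  assumes Q: "\<And>i. i \<le> n \<Longrightarrow> is_prime_ideal (Q i)" and strict: "\<And>i. i < n \<Longrightarrow> Q i \<subset> Q (Suc i)"
  shows "n \<le> CARD('n)"
proof (rule ccontr)
  assume "\<not> n \<le> CARD('n)"
  define N where "N = Suc CARD('n)"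
  have N: "N \<le> n"
    using \<open>\<not> n \<le> CARD('n)\<close> by (simp add: N_def)
  have "\<forall>i<N. \<exists>f. f \<in> Q (Suc i) - Q i"
    using strict N by (meson Diff_iff less_le_trans psubset_imp_ex_mem)
  then obtain f where f: "\<And>i. i < N \<Longrightarrow> f i \<in> Q (Suc i) - Q i"
    by metis
  define scale where "scale c g = single 0 c * g" for c :: 'a and g :: "('n, 'a) mpoly"
  interpret V: vector_space scale
    by unfold_locales (auto simp: scale_def algebra_simps single_add mult_single simp flip: mult.assoc)
  define B where "B = Max (\<Union>i\<in>{..<N}. \<Union>m\<in>keys (f i). range (lookup m))"
  have B: "exponents_le B (f i)" if "i < N" for i
    unfolding exponents_le_def B_def using that by (intro ballI allI Max_ge) auto
  \<comment> \<open>With v variables this choice gives (N D B + 1)^v <= ((N B + 1)(D + 1))^v = D (D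
    + 1)^v < (D + 1)^(v + 1).\<close>
  define D where "D = Suc (N * B) ^ CARD('n)"
  define E where "E = PiE {..<N} (\<lambda>_. {..D})"
  have fin_E: "finite E"
    by (auto simp: E_def intro: finite_PiE)
  define M where "M e = (\<Prod>i\<in>{0..<N}. f i ^ e i)" for e :: "nat \<Rightarrow> nat"
  have indep: "\<forall>e\<in>E'. c e = 0" if "E' \<subseteq> E" "(\<Sum>e\<in>E'. scale (c e) (M e)) = 0" for E' c
  proof (rule prime_chain_independent[where n = N and Q = Q and f = f and j = 0])
    show "e = e'" if "e \<in> E'" "e' \<in> E'" "\<forall>i\<in>{0..<N}. e i = e' i" for e e'
      using that \<open>E' \<subseteq> E\<close> by (intro PiE_ext[of e "{..<N}" "\<lambda>_. {..D}" e']) (auto simp: E_def)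
    show "(\<Sum>e\<in>E'. single 0 (c e) * (\<Prod>i\<in>{0..<N}. f i ^ e i)) \<in> Q 0"
      using that(2) is_ideal_0[OF is_prime_ideal_imp_is_ideal[OF Q[of 0]]] by (simp add: scale_def M_def)
    show "Q i \<subseteq> Q (Suc i)" if "i < N" for i
      using strict[of i] N that by auto
    show "finite E'"
      using fin_E that(1) finite_subset by blast
  qed (use Q f N in auto)
  have inj: "inj_on M E"
  proof (rule inj_onI, rule ccontr)
    fix e e' assume e: "e \<in> E" "e' \<in> E" "M e = M e'" "e \<noteq> e'"
    then have "(\<Sum>x\<in>{e, e'}. scale (if x = e then 1 else - 1) (M x)) = 0"
      by (simp add: scale_def single_uminus)
    then show False
      using indep[of "{e, e'}" "\<lambda>x. if x = e then 1 else - 1"] e by auto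
  qed
  have "V.independent (M ` E)"
  proof (rule V.independent_if_scalars_zero)
    fix c x assume *: "(\<Sum>x\<in>M ` E. scale (c x) x) = 0" and x: "x \<in> M ` E"
    have "(\<Sum>e\<in>E. scale (c (M e)) (M e)) = 0"
      using * inj by (simp add: sum.reindex)
    then show "c x = 0"
      using indep[of E "\<lambda>e. c (M e)"] x by blast
  qed (use fin_E in simp)
  moreover define T where "T = (\<lambda>m. single m (1 :: 'a)) ` {m. \<forall>i. lookup (m :: 'n monom) i \<le> N * (D * B)}"
  have fin_T: "finite T" and card_T: "card T \<le> Suc (N * (D * B)) ^ CARD('n)"
  proof -
    define H where "H = (UNIV :: 'n set) \<rightarrow>\<^sub>E {..N * (D * B)}"
    have "m \<in> monom_of ` H" if "\<forall>i. lookup m i \<le> N * (D * B)" for m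
    proof
      show "m = monom_of (lookup m)"
        by (rule poly_mapping_eqI) simp
    qed (use that in \<open>auto simp: H_def\<close>)
    then have T: "T \<subseteq> (\<lambda>h. single (monom_of h) 1) ` H"
      unfolding T_def by blast
    have fin_H: "finite H"
      unfolding H_def by (intro finite_PiE) auto
    show "finite T"
      using T fin_H finite_subset by blast
    have "card T \<le> card H"
      using T fin_H card_mono card_image_le by (metis finite_imageI le_trans)
    also have "card H = Suc (N * (D * B)) ^ CARD('n)"
      unfolding H_def by (simp add: card_PiE)
    finally show "card T \<le> Suc (N * (D * B)) ^ CARD('n)" .
  qed
  have "M e \<in> V.span T" if e: "e \<in> E" for e
  proof -
    have "exponents_le (D * B) (f i ^ e i)" if "i \<in> {0..<N}" for i
    proof (rule exponents_le_mono)
      show "exponents_le (e i * B) (f i ^ e i)"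
        using that by (intro exponents_le_power B) auto
      show "e i * B \<le> D * B"
        using e that by (intro mult_right_mono) (auto simp: E_def)
    qed
    then have "exponents_le (card {0..<N} * (D * B)) (M e)"
      unfolding M_def by (rule exponents_le_prod)
    then have "single m 1 \<in> T" if "m \<in> keys (M e)" for m
      using that by (auto simp: T_def exponents_le_def)
    then have "(\<Sum>m\<in>keys (M e). scale (lookup (M e) m) (single m 1)) \<in> V.span T"
      by (intro V.span_sum V.span_scale V.span_base)
    also have "(\<Sum>m\<in>keys (M e). scale (lookup (M e) m) (single m 1)) = M e"
      using poly_mapping_sum_single[of "M e"] by (simp add: scale_def mult_single)
    finally show ?thesis .
  qed
  ultimately have "card (M ` E) \<le> card T"
    using V.independent_span_bound[OF fin_T, of "M ` E"] by blast
  moreover have "card (M ` E) = Suc D ^ N"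
    using card_image[OF inj] by (simp add: E_def card_PiE)
  ultimately have "Suc D ^ N \<le> Suc (N * (D * B)) ^ CARD('n)"
    using card_T by simp
  also have "\<dots> \<le> (Suc (N * B) * Suc D) ^ CARD('n)"
    by (intro power_mono) (auto simp: algebra_simps)
  also have "\<dots> = D * Suc D ^ CARD('n)"
    unfolding power_mult_distrib D_def[symmetric] ..
  also have "\<dots> < Suc D ^ N"
    by (simp add: N_def)
  finally show False
    by simp
qed

section \<open>Integer heights and symbolic powers at a fixed prime\<close>

context
  fixes P :: "('n::{finite,linorder}, 'a::field) mpoly set"
  assumes P: "is_prime_ideal P"
begin

text \<open>\<open>the_enat\<close> is unspecified at infinity, so \<open>ht P\<close> carries
  information only once chains are known to be bounded.\<close>

lemma enat_ht: "enat (the_enat (height P)) = height P"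
proof -
  have "height P \<le> enat CARD('n)"
    unfolding height_def
  proof (rule Sup_least, elim CollectE exE conjE)
    fix x n and Q :: "nat \<Rightarrow> ('n, 'a) mpoly set"
    assume "x = enat n" "\<forall>i\<le>n. is_prime_ideal (Q i)" "\<forall>i<n. Q i \<subset> Q (Suc i)"
    then show "x \<le> enat CARD('n)"
      using prime_chain_length[of n Q] by simp
  qed
  then show ?thesis
    by (cases "height P") auto
qed

lemma prime_chain_le_ht:
  assumes "\<And>i. i \<le> n \<Longrightarrow> is_prime_ideal (Q i)" "\<And>i. i < n \<Longrightarrow> Q i \<subset> Q (Suc i)" "Q n = P"
  shows "n \<le> the_enat (height P)"
proof -
  have "enat n \<le> height P"
    unfolding height_def
    by (rule Sup_upper, intro CollectI exI[of _ n] conjI exI[of _ Q] refl allI impI) (use assms in auto)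
  then have "enat n \<le> enat (the_enat (height P))"
    by (simp only: enat_ht)
  then show ?thesis
    by simp
qed

text \<open>The final comparison of exponents leaves a remainder \<open>1 - ht P\<close>, which must
  not be positive.\<close>

lemma ht_pos:
  assumes "P \<noteq> {0}"
  shows "ht P \<ge> 1"
proof -
  have "{0} \<subset> P"
    using assms is_ideal_0[OF is_prime_ideal_imp_is_ideal[OF P]] by blast
  then have "1 \<le> the_enat (height P)"
    using P is_prime_ideal_zero
    by (intro prime_chain_le_ht[of 1 "\<lambda>i. if i = 0 then {0} else P"]) auto
  then show ?thesis
    by simp
qed

lemma local_generators_ht:
  obtains Y where "finite Y" "card Y \<le> the_enat (height P)" "Y \<subseteq> P" "P \<subseteq> saturation P (ideal_gen Y)"
proof -
  obtain n Q Y where "\<And>i. i \<le> n \<Longrightarrow> is_prime_ideal (Q i)" "\<And>i. i < n \<Longrightarrow> Q i \<subset> Q (Suc i)" "Q n = P"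
    and Y: "finite Y" "card Y \<le> n" "Y \<subseteq> P" "P \<subseteq> saturation P (ideal_gen Y)"
    using prime_chain_and_local_generators[OF P] by metis
  then have "n \<le> the_enat (height P)"
    using prime_chain_le_ht[of n Q] by blast
  with Y show thesis
    using that by (meson le_trans)
qed

lemma ideal_pow_saturation:
  assumes "is_ideal J" "K \<subseteq> saturation P J"
  shows "ideal_pow K n \<subseteq> saturation P (ideal_pow J n)"
proof (induction n)
  case 0
  then show ?case
    using subset_saturation[OF P, of UNIV] by (simp add: ideal_pow_0)
next
  case (Suc n)
  show ?case
  proof (rule ideal_pow_Suc_minimal)
    fix a b assume "a \<in> ideal_pow K n" "b \<in> K"
    then show "a * b \<in> saturation P (ideal_pow J (Suc n))"
      using Suc assms(2) by (intro saturation_mult[OF P _ _ ideal_pow_SucI]) auto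
  qed (intro is_ideal_saturation P is_ideal_ideal_pow assms)
qed

text \<open>Locally at \<open>P\<close>, the ideal is generated by \<open>ht P\<close> elements and the pigeonhole principle
  applies; the denominators are cleared with \<open>(L : s)\<^sup>[\<^sup>q\<^sup>] = L\<^sup>[\<^sup>q\<^sup>] : s ^ q\<close>.\<close>

lemma symbolic_power_subset_frobenius_power:
  assumes p: "prime CHAR('a)" and q: "q = CHAR('a) ^ e"
    and mk: "k \<ge> 1 \<Longrightarrow> int q * (k - 1) + ht P * (int q - 1) + 1 \<le> m"
  shows "symbolic_power P m \<subseteq> frobenius_power q (symbolic_power P k)"
proof (cases "k \<ge> 1")
  case False
  then show ?thesis
    by (simp add: symbolic_power_eq[OF P] frobenius_power_UNIV)
next
  case True
  have q_pos: "q > 0"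
    using prime_gt_0_nat[OF p] by (simp add: q)
  then have "0 \<le> int q * (k - 1) + ht P * (int q - 1)"
    using True by auto
  then have m: "m \<ge> 1"
    using mk[OF True] by simp
  obtain Y where Y: "finite Y" "card Y \<le> the_enat (height P)" "Y \<subseteq> P" "P \<subseteq> saturation P (ideal_gen Y)"
    by (rule local_generators_ht)
  have Y_P: "ideal_gen Y \<subseteq> P"
    using Y(3) is_prime_ideal_imp_is_ideal[OF P] by (intro ideal_gen_minimal)
  show ?thesis
  proof
    fix f assume "f \<in> symbolic_power P m"
    then obtain t where t: "t \<notin> P" "t * f \<in> ideal_pow P (nat m)"
      using m by (auto simp: symbolic_power_eq[OF P] saturation_def)
    then have "t * f \<in> saturation P (ideal_pow (ideal_gen Y) (nat m))"
      using ideal_pow_saturation[OF is_ideal_gen Y(4)] by blast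
    then have "f \<in> saturation P (ideal_pow (ideal_gen Y) (nat m))"
      by (rule mem_saturation_cancel[OF P t(1)])
    then obtain s where s: "s \<notin> P" "s * f \<in> ideal_pow (ideal_gen Y) (nat m)"
      by (auto simp: saturation_def)
    have "int (card Y) * (int q - 1) \<le> ht P * (int q - 1)"
      using Y(2) q_pos by (intro mult_right_mono) auto
    then have "int q * k + int (card Y) * (int q - 1) < m + int q"
      using mk[OF True] by (simp add: algebra_simps)
    then have "int (q * nat k + card Y * (q - 1)) < int (nat m + q)"
      using True m q_pos by (simp add: of_nat_diff)
    then have "q * nat k + card Y * (q - 1) < nat m + q"
      by (simp only: of_nat_less_iff)
    then have "ideal_pow (ideal_gen Y) (nat m) \<subseteq> frobenius_power q (ideal_pow (ideal_gen Y) (nat k))"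
      by (rule ideal_pow_subset_frobenius_power[OF Y(1) q_pos])
    also have "\<dots> \<subseteq> frobenius_power q (ideal_pow P (nat k))"
      using Y_P is_prime_ideal_imp_is_ideal[OF P] by (intro frobenius_power_mono ideal_pow_mono)
    finally have "s * f \<in> frobenius_power q (ideal_pow P (nat k))"
      using s(2) by blast
    \<comment> \<open>Completes \<open>s\<close> to a q-th power, the kind of multiplier that the
      colon property removes.\<close>
    then have "s ^ (q - 1) * (s * f) \<in> frobenius_power q (ideal_pow P (nat k))"
      by (rule is_ideal_mult[OF frobenius_power_ideal])
    also have "s ^ (q - 1) * (s * f) = f * s ^ q"
      using q_pos by (cases q) (auto simp: ac_simps)
    finally have "f \<in> frobenius_power q {x. x * s \<in> ideal_pow P (nat k)}"
      by (rule frobenius_power_colon[OF p q is_ideal_ideal_pow[OF is_prime_ideal_imp_is_ideal[OF P]]])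
    moreover have "{x. x * s \<in> ideal_pow P (nat k)} \<subseteq> symbolic_power P k"
      using s(1) True by (auto simp: symbolic_power_eq[OF P] saturation_def mult.commute)
    ultimately show "f \<in> frobenius_power q (symbolic_power P k)"
      using frobenius_power_mono by blast
  qed
qed

end

section \<open>Test ideals as increasing unions of Frobenius roots\<close>

lemma frobenius_root_mono_exponent:
  fixes I :: "('n::{finite,linorder}, 'a::field) mpoly set"
  assumes p: "prime CHAR('a)" and I: "is_ideal I" and "t > 0" and "e \<le> e'"
  shows "frobenius_root (CHAR('a) ^ e) (ideal_pow I (nat \<lceil>t * real (CHAR('a) ^ e)\<rceil>)) \<subseteq>
    frobenius_root (CHAR('a) ^ e') (ideal_pow I (nat \<lceil>t * real (CHAR('a) ^ e')\<rceil>))"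
  using \<open>e \<le> e'\<close>
proof (rule lift_Suc_mono_le[rotated])
  fix e
  let ?p = "CHAR('a)"
  let ?N = "\<lambda>e. nat \<lceil>t * real (?p ^ e)\<rceil>"
  let ?L = "frobenius_root (?p ^ Suc e) (ideal_pow I (?N (Suc e)))"
  have L: "is_ideal ?L"
    by (rule frobenius_root_ideal[OF p refl])
  have "t * real (?p ^ Suc e) = real ?p * (t * real (?p ^ e))"
    by simp
  also have "\<dots> \<le> real ?p * real_of_int \<lceil>t * real (?p ^ e)\<rceil>"
    by (intro mult_left_mono) auto
  also have "\<dots> = real_of_int (int ?p * \<lceil>t * real (?p ^ e)\<rceil>)"
    by simp
  \<comment> \<open>The bound ceil(p x) <= p ceil(x) is what lets the p-th power of an element from
    stage \<open>e\<close> enter stage \<open>e + 1\<close>; a p-th root is extracted at the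
    end.\<close>
  finally have "\<lceil>t * real (?p ^ Suc e)\<rceil> \<le> int ?p * \<lceil>t * real (?p ^ e)\<rceil>"
    by (simp only: ceiling_le_iff)
  then have "?N (Suc e) \<le> nat (int ?p * \<lceil>t * real (?p ^ e)\<rceil>)"
    by (rule nat_mono)
  then have N: "?N (Suc e) \<le> ?N e * ?p"
    by (simp add: nat_mult_distrib mult.commute)
  have "f \<in> frobenius_power (?p ^ e) ?L" if f: "f \<in> ideal_pow I (?N e)" for f
  proof -
    have "f ^ ?p \<in> ideal_pow I (?N e * ?p)"
      by (rule ideal_pow_power[OF I f])
    also have "\<dots> \<subseteq> ideal_pow I (?N (Suc e))"
      by (rule ideal_pow_antimono[OF I N])
    also have "\<dots> \<subseteq> frobenius_power (?p ^ Suc e) ?L"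
      by (rule subset_frobenius_power_root[OF p refl])
    also have "\<dots> \<subseteq> frobenius_power ?p (frobenius_power (?p ^ e) ?L)"
    proof (rule frobenius_power_minimal[OF frobenius_power_ideal])
      fix g assume "g \<in> ?L"
      then have "(g ^ (?p ^ e)) ^ ?p \<in> frobenius_power ?p (frobenius_power (?p ^ e) ?L)"
        by (intro power_in_frobenius_power)
      then show "g ^ (?p ^ Suc e) \<in> frobenius_power ?p (frobenius_power (?p ^ e) ?L)"
        by (simp add: mult.commute flip: power_mult)
    qed
    finally show ?thesis
      using frobenius_power_power_iff[OF p, of ?p 1] frobenius_power_ideal by auto
  qed
  then show "frobenius_root (?p ^ e) (ideal_pow I (?N e)) \<subseteq> ?L"
    by (intro frobenius_root_minimal[OF p refl] L) blast
qed

text \<open>Two members of the increasing union meet at the larger of their stages. As the union is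
  an ideal, the sum over \<open>P\<close> can be compared with it on generators.\<close>

lemma is_ideal_test_ideal:
  fixes I :: "('n::{finite,linorder}, 'a::field) mpoly set"
  assumes p: "prime CHAR('a)" and I: "is_ideal I" and t: "t > 0"
  shows "is_ideal (test_ideal CHAR('a) t I)"
proof -
  define R where "R e = frobenius_root (CHAR('a) ^ e) (ideal_pow I (nat \<lceil>t * real (CHAR('a) ^ e)\<rceil>))" for e
  have R: "is_ideal (R e)" for e
    unfolding R_def by (rule frobenius_root_ideal[OF p refl])
  have mono: "R e \<subseteq> R e'" if "e \<le> e'" for e e'
    unfolding R_def by (rule frobenius_root_mono_exponent[OF p I t that])
  have T: "test_ideal CHAR('a) t I = (\<Union>e\<in>{0<..}. R e)"
    by (simp add: test_ideal_def R_def)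
  show ?thesis
    unfolding is_ideal_iff T
  proof (intro conjI ballI allI)
    show "0 \<in> (\<Union>e\<in>{0<..}. R e)"
      using is_ideal_0[OF R, of 1] by auto
    fix x r assume "x \<in> (\<Union>e\<in>{0<..}. R e)"
    then obtain e where e: "e > 0" "x \<in> R e"
      by auto
    then show "r * x \<in> (\<Union>e\<in>{0<..}. R e)"
      using is_ideal_mult[OF R] by auto
    fix y assume "y \<in> (\<Union>e\<in>{0<..}. R e)"
    then obtain e' where e': "e' > 0" "y \<in> R e'"
      by auto
    have "x + y \<in> R (max e e')"
      using e e' mono[of e "max e e'"] mono[of e' "max e e'"] by (intro is_ideal_add R) auto
    then show "x + y \<in> (\<Union>e\<in>{0<..}. R e)"
      using e by (intro UN_I[of "max e e'"]) auto
  qed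
qed

text \<open>\<open>F \<noteq> 0\<close> is implicit in speaking of an initial monomial.\<close>

theorem theorem4p3:
  fixes I :: "('n::{finite,linorder}, 'a::field) mpoly set"
    and \<pp> :: "'k::finite \<Rightarrow> ('n, 'a) mpoly set"
    and P :: "(real ^ 'k) set"
    and ord :: "'n monom rel"
    and F :: "('n, 'a) mpoly"
  assumes "CHAR('a) > 0"
    and "is_ideal I"
    and "\<And>i. is_prime_ideal (\<pp> i)"
    and "\<And>i. \<pp> i \<noteq> {0}"
    and "polytope P"
    and "\<forall>\<^sub>F s in sequentially.
           integral_closure (ideal_pow I s) =
           ideal_family_sum P (\<lambda>a. \<Inter>i. symbolic_power (\<pp> i) \<lceil>real s * a $ i\<rceil>)"
    and "term_order ord"
    and "F \<noteq> 0" and "squarefree_monom (initial_monom ord F)"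
    and "\<And>i. F \<in> symbolic_power (\<pp> i) (ht (\<pp> i))"
  shows "\<forall>t>0. test_ideal CHAR('a) t I =
           ideal_family_sum P
             (\<lambda>a. \<Inter>i. symbolic_power (\<pp> i) (\<lfloor>t * a $ i\<rfloor> + 1 - ht (\<pp> i)))"
proof (intro allI impI)
  fix t :: real assume t: "t > 0"
  let ?p = "CHAR('a)"
  have p: "prime ?p"
    using assms(1) by (rule prime_CHAR_semidom)
  have p1: "real ?p > 1"
    using prime_gt_1_nat[OF p] by simp
  obtain s0 where s0: "\<And>s. s \<ge> s0 \<Longrightarrow> integral_closure (ideal_pow I s) =
      ideal_family_sum P (\<lambda>a. \<Inter>i. symbolic_power (\<pp> i) \<lceil>real s * a $ i\<rceil>)"
    using assms(6) by (auto simp: eventually_sequentially)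
  define N where "N e = nat \<lceil>t * real (?p ^ e)\<rceil>" for e
  define R where "R e = frobenius_root (?p ^ e) (ideal_pow I (N e))" for e
  define k where "k a i = \<lfloor>t * a $ i\<rfloor> + 1 - ht (\<pp> i)" for a :: "real ^ 'k" and i
  define S where "S = ideal_family_sum P (\<lambda>a. \<Inter>i. symbolic_power (\<pp> i) (k a i))"
  have test: "test_ideal ?p t I = (\<Union>e\<in>{0<..}. R e)"
    by (simp add: test_ideal_def R_def N_def)
  have N_ge: "t * real (?p ^ e) \<le> real (N e)" and N_le: "real (N e) \<le> t * real (?p ^ e) + 1" for e
  proof -
    have "real (N e) = real_of_int \<lceil>t * real (?p ^ e)\<rceil>"
      using t by (simp add: N_def)
    then show "t * real (?p ^ e) \<le> real (N e)" "real (N e) \<le> t * real (?p ^ e) + 1"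
      by linarith+
  qed
  have large: "\<exists>e'\<ge>e. B \<le> real (?p ^ e')" for e and B :: real
  proof -
    obtain d where d: "B < real ?p ^ d"
      using real_arch_pow[OF p1] by blast
    also have "\<dots> \<le> real ?p ^ max d e"
      using p1 by (intro power_increasing) auto
    finally show ?thesis
      by (intro exI[of _ "max d e"]) auto
  qed
  have N_large: "s0 \<le> N e" if "real s0 / t \<le> real (?p ^ e)" for e
  proof -
    have "real s0 \<le> t * real (?p ^ e)"
      using that t by (simp add: field_simps)
    then show ?thesis
      using N_ge[of e] by linarith
  qed
  have "R e \<subseteq> S" for e
  proof -
    \<comment> \<open>Stage \<open>e\<close> may be too early for the description of integral
      closures, so a later stage, which contains it, takes its place.\<close>
    obtain e' where e': "e' \<ge> e" "real s0 / t \<le> real (?p ^ e')"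
      using large[of e] by blast
    let ?q = "?p ^ e'"
    have "R e \<subseteq> R e'"
      unfolding R_def N_def by (rule frobenius_root_mono_exponent[OF p assms(2) t e'(1)])
    also have "R e' \<subseteq> S"
      unfolding R_def
    proof (rule frobenius_root_minimal[OF p refl])
      show "is_ideal S"
        by (simp add: S_def ideal_family_sum_def is_ideal_gen)
      have "symbolic_power (\<pp> i) \<lceil>real (N e') * a $ i\<rceil> \<subseteq> frobenius_power ?q (symbolic_power (\<pp> i) (k a i))"
        for a i
      proof (rule symbolic_power_subset_frobenius_power[OF assms(3) p refl])
        \<comment> \<open>This makes \<open>a $ i\<close> nonnegative, as is needed to replace
          \<open>N e'\<close> by its lower bound. For smaller \<open>k a i\<close> the target is the
          whole ring.\<close>
        assume "1 \<le> k a i"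
        have ht: "1 \<le> ht (\<pp> i)"
          by (rule ht_pos[OF assms(3,4)])
        with \<open>1 \<le> k a i\<close> have "0 \<le> \<lfloor>t * a $ i\<rfloor>"
          unfolding k_def by linarith
        then have "0 \<le> t * a $ i"
          by (simp only: zero_le_floor)
        then have a: "0 \<le> a $ i"
          using t by (simp add: zero_le_mult_iff)
        have "real_of_int (int ?q * \<lfloor>t * a $ i\<rfloor>) \<le> real ?q * (t * a $ i)"
          by (simp add: mult_left_mono)
        also have "\<dots> \<le> real (N e') * a $ i"
          using mult_right_mono[OF N_ge[of e'] a] by (simp add: ac_simps)
        finally have "int ?q * \<lfloor>t * a $ i\<rfloor> \<le> \<lceil>real (N e') * a $ i\<rceil>"
          by linarith
        \<comment> \<open>The left side collapses to q floor(t a) + 1 - ht, and ht >= 1.\<close>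
        then show "int ?q * (k a i - 1) + ht (\<pp> i) * (int ?q - 1) + 1 \<le> \<lceil>real (N e') * a $ i\<rceil>"
          using ht by (simp add: k_def algebra_simps)
      qed
      then have "(\<Inter>i. symbolic_power (\<pp> i) \<lceil>real (N e') * a $ i\<rceil>) \<subseteq>
          frobenius_power ?q (\<Inter>i. symbolic_power (\<pp> i) (k a i))" for a
        by (intro subsetI frobenius_power_Inter[OF p refl] is_ideal_symbolic_power assms(3)) blast
      moreover have "frobenius_power ?q (\<Inter>i. symbolic_power (\<pp> i) (k a i)) \<subseteq> frobenius_power ?q S"
        if "a \<in> P" for a
        unfolding S_def ideal_family_sum_def using that
        by (intro frobenius_power_mono order_trans[OF _ ideal_gen_superset]) blast
      ultimately have "integral_closure (ideal_pow I (N e')) \<subseteq> frobenius_power ?q S"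
        unfolding s0[OF N_large[OF e'(2)]] ideal_family_sum_def
        by (intro ideal_gen_minimal frobenius_power_ideal) blast
      then show "ideal_pow I (N e') \<subseteq> frobenius_power ?q S"
        using subset_integral_closure[OF is_ideal_ideal_pow[OF assms(2)]] by blast
    qed
    finally show ?thesis .
  qed
  moreover have "f \<in> (\<Union>e\<in>{0<..}. R e)" if a: "a \<in> P" and f: "f \<in> (\<Inter>i. symbolic_power (\<pp> i) (k a i))" for a f
  proof -
    obtain G where G: "finite G" "I = ideal_gen G"
      using ideal_finitely_generated[OF assms(7,2)] .
    \<comment> \<open>The distance from \<open>t * a $ i\<close> to the next strictly larger integer
      is positive even at integers; multiplied by q it outgrows every constant.\<close>
    define \<delta> where "\<delta> i = real_of_int \<lfloor>t * a $ i\<rfloor> + 1 - t * a $ i" for i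
    have \<delta>: "\<delta> i > 0" for i
      unfolding \<delta>_def by linarith
    \<comment> \<open>What this gap must absorb: one height, because \<open>F\<close> occurs only q
      - 1 times, the rounding of \<open>N e\<close> by at most 1, and the shift by
      \<open>card G\<close>. The absolute value allows for negative coordinates.\<close>
    define b where "b i = real_of_int (ht (\<pp> i)) + (1 + real (card G)) * \<bar>a $ i\<bar>" for i
    have b: "b i \<ge> 0" for i
      by (simp add: b_def)
    \<comment> \<open>The sum dominates each of its quotients at once, and the first summand takes
      \<open>N e\<close> beyond \<open>s0\<close>. The stage is positive, as the union in the test
      ideal requires.\<close>
    obtain e where e: "e \<ge> 1" "real s0 / t + (\<Sum>i\<in>UNIV. b i / \<delta> i) \<le> real (?p ^ e)"
      using large[of 1] by blast
    define q where "q = ?p ^ e"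
    have q_pos: "q > 0"
      using p1 by (simp add: q_def)
    have q_b: "b i \<le> real q * \<delta> i" for i
    proof -
      have "b i / \<delta> i \<le> (\<Sum>i\<in>UNIV. b i / \<delta> i)"
        using b \<delta> by (intro member_le_sum) (auto simp: less_imp_le)
      moreover have "0 \<le> real s0 / t"
        using t by simp
      ultimately have "b i / \<delta> i \<le> real q"
        using e(2) by (simp add: q_def)
      then show ?thesis
        using \<delta>[of i] by (simp only: pos_divide_le_eq)
    qed
    have "0 \<le> (\<Sum>i\<in>UNIV. b i / \<delta> i)"
      using b \<delta> by (intro sum_nonneg) (auto simp: less_imp_le)
    then have s0_le: "s0 \<le> N e"
      using e(2) by (intro N_large) simp
    \<comment> \<open>The right side is q (floor(t a) + 1) - ht, that is q t a + q \<delta> -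
      ht.\<close>
    have exp_le: "\<lceil>real (N e + card G) * a $ i\<rceil> \<le> int q * k a i + (int q - 1) * ht (\<pp> i)" for i
    proof -
      define \<theta> where "\<theta> = real (N e) - t * real q"
      have \<theta>: "0 \<le> \<theta>" "\<theta> \<le> 1"
        using N_ge[of e] N_le[of e] by (simp_all add: \<theta>_def q_def)
      have "real (N e + card G) * a $ i = real q * (t * a $ i) + (\<theta> + real (card G)) * a $ i"
        by (simp add: \<theta>_def algebra_simps)
      also have "(\<theta> + real (card G)) * a $ i \<le> (\<theta> + real (card G)) * \<bar>a $ i\<bar>"
        using \<theta> by (intro mult_left_mono) auto
      also have "\<dots> \<le> (1 + real (card G)) * \<bar>a $ i\<bar>"
        using \<theta> by (intro mult_right_mono) auto
      also have "\<dots> = b i - real_of_int (ht (\<pp> i))"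
        by (simp add: b_def)
      also have "\<dots> \<le> real q * \<delta> i - real_of_int (ht (\<pp> i))"
        using q_b by simp
      also have "real q * (t * a $ i) + \<dots> = real_of_int (int q * k a i + (int q - 1) * ht (\<pp> i))"
        by (simp add: \<delta>_def k_def algebra_simps)
      finally show ?thesis
        by (simp add: ceiling_le_iff)
    qed
    have "f ^ q * F ^ (q - 1) \<in> symbolic_power (\<pp> i) \<lceil>real (N e + card G) * a $ i\<rceil>" for i
    proof -
      have "f ^ q * F ^ (q - 1) \<in> symbolic_power (\<pp> i) (int q * k a i + int (q - 1) * ht (\<pp> i))"
        using f assms(10) by (intro symbolic_power_mult symbolic_power_power assms(3)) auto
      then show ?thesis
        using symbolic_power_antimono[OF assms(3) exp_le] q_pos by (auto simp: of_nat_diff)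
    qed
    then have "f ^ q * F ^ (q - 1) \<in>
        ideal_family_sum P (\<lambda>a. \<Inter>i. symbolic_power (\<pp> i) \<lceil>real (N e + card G) * a $ i\<rceil>)"
      unfolding ideal_family_sum_def using a by (intro subsetD[OF ideal_gen_superset]) blast
    then have "f ^ q * F ^ (q - 1) \<in> integral_closure (ideal_pow I (N e + card G))"
      using s0[of "N e + card G"] s0_le by simp
    then have "f ^ q * F ^ (q - 1) \<in> ideal_pow I (N e)"
      using briancon_skoda[OF p G] by blast
    then have mem: "F ^ (q - 1) * f ^ q \<in> frobenius_power q (R e)"
      using subset_frobenius_power_root[OF p refl, of "ideal_pow I (N e)" e]
      by (auto simp: R_def q_def mult.commute)
    define v where "v = initial_monom ord F"
    have v: "v \<in> keys F" "\<forall>m\<in>keys F. (m, v) \<in> ord"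
      using leading_initial_monom[OF assms(7,8)] by (simp_all add: v_def leading_def[OF assms(7)])
    note top = lookup_leading_power[OF assms(7) v(2), of "q - 1"]
    have "f \<in> R e"
    proof (rule frobenius_power_cancel[OF p q_def _ mem, of "monom_scale (q - 1) v"])
      show "is_ideal (R e)"
        unfolding R_def by (rule frobenius_root_ideal[OF p refl])
      \<comment> \<open>Squarefreeness enters here: the initial monomial of F^(q-1) has exponents at
        most q - 1 and is its own residue modulo q.\<close>
      show "lookup (monom_scale (q - 1) v) i < q" for i
      proof -
        have "(q - 1) * lookup v i \<le> (q - 1) * 1"
          using assms(9) by (intro mult_left_mono) (auto simp: v_def squarefree_monom_def)
        then show ?thesis
          unfolding lookup_monom_scale using q_pos by linarith
      qed
      show "lookup (F ^ (q - 1)) (monom_scale (q - 1) v) \<noteq> 0"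
        using top v(1) by (simp add: in_keys_iff)
      \<comment> \<open>Any exponent of F^(q-1) in this residue class is a multiple of the top one,
        so it must equal it.\<close>
      fix w assume "monom_scale q w + monom_scale (q - 1) v \<in> keys (F ^ (q - 1))"
      then have "(monom_scale q w + monom_scale (q - 1) v, monom_scale (q - 1) v) \<in> ord"
        using top by blast
      moreover have "(monom_scale (q - 1) v, monom_scale q w + monom_scale (q - 1) v) \<in> ord"
        using term_order_add_self[OF assms(7)] by (metis add.commute)
      ultimately have "monom_scale q w + monom_scale (q - 1) v = monom_scale (q - 1) v"
        by (rule term_order_antisym[OF assms(7)])
      then have "monom_scale q w = monom_scale q 0"
        by simp
      then show "w = 0"
        using q_pos by (simp only: monom_scale_inject)
    qed
    then show ?thesis
      using e(1) by auto
  qed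
  then have "S \<subseteq> (\<Union>e\<in>{0<..}. R e)"
    unfolding S_def ideal_family_sum_def
    using is_ideal_test_ideal[OF p assms(2) t] by (intro ideal_gen_minimal) (auto simp: test)
  ultimately show "test_ideal ?p t I = ideal_family_sum P
      (\<lambda>a. \<Inter>i. symbolic_power (\<pp> i) (\<lfloor>t * a $ i\<rfloor> + 1 - ht (\<pp> i)))"
    unfolding test S_def k_def by blast
qed

end
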